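(* Let $2\le k\le n-2$. The positive tropical Grassmannian $\text{Trop}^+G(k,n)$ maps surjectively onto $\mathcal{Z}_{k,n}$ with fiber the lineality space. Explicitly, the linear map $\Phi:\mathbb{R}^{\binom{n}{k}}\to\mathfrak{B}_{k,n}$, $\Phi\left(\sum_J \pi_J e^J\right)=\sum_J \pi_J\mathcal{L}_J$, satisfies $\Phi(\text{Trop}^+G(k,n))=\mathcal{Z}_{k,n}$, and each fiber of the restriction of $\Phi$ to $\text{Trop}^+G(k,n)$ is a coset of the lineality space $$\text{span}\left\{\sum_{J\in\binom{[n]}{k}:\,J\ni a}e^J:\ a=1,\ldots,n\right\}\subset\mathbb{R}^{\binom{n}{k}}.$$
   Context: Write $[n]=\{1,\ldots,n\}$ with the standard cyclic order $(1,2,\ldots,n)$, indices modulo $n$; let $\{e^J: J\in\binom{[n]}{k}\}$ be the standard basis of $\mathbb{R}^{\binom{n}{k}}$. Positive tropical Grassmannian. $\text{Trop}^+G(k,n)$ is the set of all positive tropical Plücker vectors, i.e. all $\pi=\sum_J\pi_Je^J\in\mathbb{R}^{\binom{n}{k}}$ such that $$\pi_{Lac}+\pi_{Lbd}=\min\{\pi_{Lad}+\pi_{Lbc},\ \pi_{Lab}+\pi_{Lcd}\}$$ for all $a<b<c<d$ in cyclic order and all $L\in\binom{[n]\setminus\{a,b,c,d\}}{k-2}$ (here $Lac$ means $L\cup\{a,c\}$, etc.). Blade spaces. For $L\subset[n]$, the set $[n]\setminus L$ carries the inherited ("gapped") cyclic order. A subset $J\subseteq[n]\setminus L$ is frozen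 if it is a cyclic interval (a set of consecutive elements) for this cyclic order, and nonfrozen otherwise. $\mathfrak{B}^{(L)}_{k,n}$ is the real vector space with basis the formal symbols $\beta^{(L)}_J$, where $J$ ranges over the nonfrozen $(k-|L|)$-element subsets of $[n]\setminus L$; one sets $\beta^{(L)}_J=0$ if $J$ is frozen. For $L=\emptyset$ write $\beta_J$ and $\mathfrak{B}_{k,n}$. Boundary operators. $\partial_j$ is the linear operator with $\partial_j(\beta^{(L)}_J)=0$ if $j\in L$, and $\partial_j(\beta^{(L)}_J)=\beta^{(L\cup\{j\})}_{J\setminus\{\ell\}}$ if $j\notin L$, where $\ell=j$ if $j\in J$, and otherwise $\ell$ is the cyclically next element after $j$ that lies in $J$. For $L=\{\ell_1<\cdots<\ell_d\}$, $\partial_L=\partial_{\ell_1}\cdots\partial_{\ell_d}$. Elements $\mathcal{L}_J$. For $J\in\binom{[n]}{k}$ let $j_1,\ldots,j_t$ be the cyclic initial points of the (maximal) cyclic intervals of $J$. For $M=(m_1,\ldots,m_t)\in\{0,1\}^t$ let $J_M$ be obtained from $J$ by replacing each $j_a$ by $j_a-m_a$ (mod $n$). Then $\mathcal{L}_J=\sum_{M\in\{0,1\}^t}(-1)^{1+M\cdot M}\beta_{J_M}\in\mathfrak{B}_{k,n}$, where $M\cdot M$ is the number of ones in $M$. The set $\mathcal{Z}_{k,n}$. $\mathcal{Z}_{k,n}\subset\mathfrak{B}_{k,n}$ is the set of all $\beta\in\mathfrak{B}_{k,n}$ such that for every $L\in\binom{[n]}{k-2}$, expanding $\partial_L(\beta)=\sum\omega^{(L)}_{ij}\beta^{(L)}_{ij}$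 over nonfrozen pairs $\{i,j\}\subset[n]\setminus L$: (1) all $\omega^{(L)}_{ij}\ge0$; and (2) the support $\{\beta^{(L)}_{ij}:\omega^{(L)}_{ij}\ne0\}$ is a matroidal blade arrangement, i.e. the pairs $\{i,j\}$ in the support are pairwise weakly separated with respect to the cyclic order on $[n]\setminus L$. Two pairs $\{i,j\},\{a,b\}$ fail to be weakly separated exactly when they are disjoint and cross (i.e. $i<a<j<b$ up to cyclic rotation and exchanging $a$ and $b$). *)

theory Defs
  imports "HOL-Analysis.Finite_Function_Topology" "HOL-Library.Ramsey"
begin

text \<open>
  Coordinate vectors and formal linear combinations are finitely supported functions
  (\<^typ>\<open>'a \<Rightarrow>\<^sub>0 real\<close>), a real vector space whose standard basis vectors are
  \<^term>\<open>Poly_Mapping.single x (1::real)\<close>. The set of \<^term>\<open>k\<close>-element subsets of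
  \<^term>\<open>{1..n}\<close> is \<^term>\<open>nsets {1..n} k\<close>.
\<close>

section \<open>The cyclic order on \<open>{1..n}\<close>\<close>

text \<open>Number of clockwise steps from \<open>a\<close> to \<open>b\<close>, for \<open>a, b\<close> in \<open>{1..n}\<close>.\<close>

definition cdist :: "nat \<Rightarrow> nat \<Rightarrow> nat \<Rightarrow> nat" where
  "cdist n a b = (b + n - a) mod n"

text \<open>
  \<open>a < b < c < d\<close> up to cyclic rotation. The gapped cyclic order on \<open>{1..n} - L\<close> is the
  restriction of this relation.
\<close>

definition cyc4 :: "nat \<Rightarrow> nat \<Rightarrow> nat \<Rightarrow> nat \<Rightarrow> nat \<Rightarrow> bool" where
  "cyc4 n a b c d \<longleftrightarrow> {a, b, c, d} \<subseteq> {1..n} \<and>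
     0 < cdist n a b \<and> cdist n a b < cdist n a c \<and> cdist n a c < cdist n a d"

text \<open>
  Consecutive elements of \<open>S\<close> are those lying on an arc \<open>a, a + 1, \<dots>, a + m - 1\<close> of the full
  cyclic order.
\<close>

definition cyclic_interval :: "nat \<Rightarrow> nat set \<Rightarrow> nat set \<Rightarrow> bool" where
  "cyclic_interval n S J \<longleftrightarrow> (\<exists>a\<in>{1..n}. \<exists>m. J = {x \<in> S. cdist n a x < m})"

definition cyc_pred :: "nat \<Rightarrow> nat \<Rightarrow> nat" where
  "cyc_pred n j = (if j = 1 then n else j - 1)"

section \<open>Positive tropical Pluecker vectors\<close>

definition plucker_space :: "nat \<Rightarrow> nat \<Rightarrow> (nat set \<Rightarrow>\<^sub>0 real) set" where
  "plucker_space k n = {\<pi>. Poly_Mapping.keys \<pi> \<subseteq> nsets {1..n} k}"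

definition trop_plus_G :: "nat \<Rightarrow> nat \<Rightarrow> (nat set \<Rightarrow>\<^sub>0 real) set" where
  "trop_plus_G k n = {\<pi> \<in> plucker_space k n.
     \<forall>a b c d. cyc4 n a b c d \<longrightarrow>
       (\<forall>L \<in> nsets ({1..n} - {a, b, c, d}) (k - 2).
          Poly_Mapping.lookup \<pi> (L \<union> {a, c}) + Poly_Mapping.lookup \<pi> (L \<union> {b, d}) =
          min (Poly_Mapping.lookup \<pi> (L \<union> {a, d}) + Poly_Mapping.lookup \<pi> (L \<union> {b, c}))
              (Poly_Mapping.lookup \<pi> (L \<union> {a, b}) + Poly_Mapping.lookup \<pi> (L \<union> {c, d})))}"

definition lineality_space :: "nat \<Rightarrow> nat \<Rightarrow> (nat set \<Rightarrow>\<^sub>0 real) set" where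
  "lineality_space k n =
     span {\<Sum>J | J \<in> nsets {1..n} k \<and> a \<in> J. Poly_Mapping.single J 1 | a. a \<in> {1..n}}"

section \<open>Blade spaces and boundary operators\<close>

definition nonfrozen :: "nat \<Rightarrow> nat set \<Rightarrow> nat set \<Rightarrow> bool" where
  "nonfrozen n L J \<longleftrightarrow> J \<subseteq> {1..n} - L \<and> \<not> cyclic_interval n ({1..n} - L) J"

text \<open>
  All blade spaces live in one direct sum: the pair \<open>(L, J)\<close> indexes the formal symbol
  \<open>\<beta>\<^sup>(\<^sup>L\<^sup>)\<^sub>J\<close>.
\<close>

type_synonym blade_vec = "(nat set \<times> nat set) \<Rightarrow>\<^sub>0 real"

definition blade :: "nat \<Rightarrow> nat set \<Rightarrow> nat set \<Rightarrow> blade_vec" where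
  "blade n L J = (if nonfrozen n L J then Poly_Mapping.single (L, J) 1 else 0)"

definition blade_space :: "nat \<Rightarrow> nat \<Rightarrow> nat set \<Rightarrow> blade_vec set" where
  "blade_space k n L =
     {\<beta>. Poly_Mapping.keys \<beta> \<subseteq> {(L, J) | J. nonfrozen n L J \<and> card J + card L = k}}"

definition next_in :: "nat \<Rightarrow> nat \<Rightarrow> nat set \<Rightarrow> nat" where
  "next_in n j J = (if j \<in> J then j else arg_min_on (cdist n j) J)"

definition boundary_basis :: "nat \<Rightarrow> nat \<Rightarrow> nat set \<Rightarrow> nat set \<Rightarrow> blade_vec" where
  "boundary_basis n j L J =
     (if j \<in> L then 0 else blade n (insert j L) (J - {next_in n j J}))"

definition boundary :: "nat \<Rightarrow> nat \<Rightarrow> blade_vec \<Rightarrow> blade_vec" where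
  "boundary n j \<beta> =
     (\<Sum>(L, J) \<in> Poly_Mapping.keys \<beta>. Poly_Mapping.lookup \<beta> (L, J) *\<^sub>R boundary_basis n j L J)"

text \<open>The composite \<open>\<partial>\<^sub>\<ell>\<^sub>1 \<cdots> \<partial>\<^sub>\<ell>\<^sub>d\<close> for \<open>L = {\<ell>\<^sub>1 < \<cdots> < \<ell>\<^sub>d}\<close>; the last factor acts first.\<close>

definition boundary_set :: "nat \<Rightarrow> nat set \<Rightarrow> blade_vec \<Rightarrow> blade_vec" where
  "boundary_set n L \<beta> = foldr (boundary n) (sorted_list_of_set L) \<beta>"

section \<open>The elements \<open>\<L>\<^sub>J\<close> and the linear map\<close>

definition initial_points :: "nat \<Rightarrow> nat set \<Rightarrow> nat set" where
  "initial_points n J = {j \<in> J. cyc_pred n j \<notin> J}"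

text \<open>A 0/1-vector indexed by the initial points is encoded as the subset \<open>M\<close> of positions of its ones.\<close>

definition L_elem :: "nat \<Rightarrow> nat set \<Rightarrow> blade_vec" where
  "L_elem n J = (\<Sum>M \<in> Pow (initial_points n J).
     (-1) ^ (1 + card M) *\<^sub>R blade n {} ((J - M) \<union> cyc_pred n ` M))"

definition Phi :: "nat \<Rightarrow> nat \<Rightarrow> (nat set \<Rightarrow>\<^sub>0 real) \<Rightarrow> blade_vec" where
  "Phi k n \<pi> = (\<Sum>J \<in> nsets {1..n} k. Poly_Mapping.lookup \<pi> J *\<^sub>R L_elem n J)"

section \<open>The set \<open>\<Z>\<^sub>k\<^sub>,\<^sub>n\<close>\<close>

definition crossing :: "nat \<Rightarrow> nat set \<Rightarrow> nat set \<Rightarrow> bool" where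
  "crossing n I J \<longleftrightarrow> (\<exists>i a j b. I = {i, j} \<and> J = {a, b} \<and> cyc4 n i a j b)"

definition matroidal_pairs :: "nat \<Rightarrow> nat set set \<Rightarrow> bool" where
  "matroidal_pairs n \<S> \<longleftrightarrow> pairwise (\<lambda>I J. \<not> crossing n I J) \<S>"

definition nonfrozen_pairs :: "nat \<Rightarrow> nat set \<Rightarrow> nat set set" where
  "nonfrozen_pairs n L = {J \<in> nsets ({1..n} - L) 2. nonfrozen n L J}"

definition Z_set :: "nat \<Rightarrow> nat \<Rightarrow> blade_vec set" where
  "Z_set k n = {\<beta> \<in> blade_space k n {}.
     \<forall>L \<in> nsets {1..n} (k - 2).
       (let \<omega> = (\<lambda>J. Poly_Mapping.lookup (boundary_set n L \<beta>) (L, J)) in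
          (\<forall>J \<in> nonfrozen_pairs n L. 0 \<le> \<omega> J) \<and>
          matroidal_pairs n {J \<in> nonfrozen_pairs n L. \<omega> J \<noteq> 0})}"

end

theory Submission
  imports Defs
begin

text \<open>
  Fix a coordinate vector \<open>\<pi>\<close>, a set \<open>S\<close> with its gapped cyclic order and write \<open>x'\<close> for the element
  of \<open>S\<close> after \<open>x\<close>. Regrouping the definition of \<open>\<Phi>\<close> by blades, the coefficient of
  \<open>\<beta>\<^sub>I\<close> in \<open>\<Phi>(\<pi>)\<close> is an alternating sum of the values \<open>\<pi>\<^sub>J\<close>, over all \<open>J\<close> obtained from \<open>I\<close> by
  moving some of the last points of its cyclic intervals one step forward. This is \<open>blade_coeff\<close>, which
  makes sense for every \<open>S\<close> (\<open>lookup_Phi\<close>).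
  
  The key point is that boundaries act on these coefficients as restrictions: the coefficients of
  \<open>\<partial>\<^sub>L \<Phi>(\<pi>)\<close> are the \<open>blade_coeff\<close> of the vector \<open>K \<mapsto> \<pi>\<^sub>L\<^sub>\<union>\<^sub>K\<close> on \<open>S = [n] - L\<close>
  (\<open>lookup_boundary_set_Phi\<close>). One boundary sums the coefficients of \<open>I \<union> {\<ell>}\<close> over an arc of positions
  \<open>\<ell>\<close>, and this sum telescopes (\<open>sum_blade_coeff_insert\<close>).
  
  For \<open>|L| = k - 2\<close> only pairs are left, and the coefficient of a pair \<open>{i, j}\<close> is the mixed second
  difference \<open>\<omega>\<^sub>i\<^sub>j = \<pi>\<^sub>i\<^sub>'\<^sub>j + \<pi>\<^sub>i\<^sub>j\<^sub>' - \<pi>\<^sub>i\<^sub>j - \<pi>\<^sub>i\<^sub>'\<^sub>j\<^sub>'\<close> (with \<open>L\<close> joined to every index). Summing over a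
  rectangle of arcs, \<open>\<pi>\<^sub>a\<^sub>d + \<pi>\<^sub>b\<^sub>c - \<pi>\<^sub>a\<^sub>c - \<pi>\<^sub>b\<^sub>d\<close> is the sum of \<open>\<omega>\<^sub>i\<^sub>j\<close> over \<open>i \<in> [a, b)\<close> and \<open>j \<in> [c, d)\<close>
  (\<open>four_point_sum\<close>). A three-term tropical relation says that two such rectangle sums are nonnegative
  and one of them vanishes. All relations together therefore say that \<open>\<omega> \<ge> 0\<close> and that no two pairs in
  its support cross (\<open>three_term_iff_nonneg_noncrossing\<close>). Hence a coordinate vector \<open>\<pi>\<close> is a positive
  tropical Pluecker vector exactly when \<open>\<Phi>(\<pi>)\<close> lies in \<open>\<Z>\<^sub>k\<^sub>,\<^sub>n\<close>.
  
  What remains is linear algebra. If \<open>\<Phi>(\<pi>) = 0\<close> then all second differences vanish, so \<open>\<pi>\<close> satisfies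
  the exchange identity \<open>\<pi>\<^sub>L\<^sub>a\<^sub>c + \<pi>\<^sub>L\<^sub>b\<^sub>d = \<pi>\<^sub>L\<^sub>a\<^sub>d + \<pi>\<^sub>L\<^sub>b\<^sub>c\<close> and is of the form \<open>\<pi>\<^sub>J = \<Sum>\<^sub>a\<^sub>\<in>\<^sub>J x\<^sub>a\<close>, that is, it lies in
  the lineality space (\<open>kernel_Phi_subset_lineality\<close>); the converse is a cancellation
  (\<open>Phi_lineality\<close>). So the kernel has dimension at most \<open>n\<close>, and since there are at least \<open>n\<close> frozen
  \<open>k\<close>-subsets, a dimension count shows that \<open>\<Phi>\<close> maps onto the blade space
  (\<open>Phi_image_plucker_space\<close>).
\<close>

section \<open>Successors and arcs in the gapped cyclic order\<close>

lemma cdist_eq: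
  assumes "a \<in> {1..n}" "b \<in> {1..n}"
  shows "cdist n a b = (if a \<le> b then b - a else b + n - a)"
proof (cases "a \<le> b")
  case True
  then have "b + n - a = (b - a) + n" by simp
  then have "(b + n - a) mod n = (b - a) mod n" by simp
  also have "\<dots> = b - a" using assms by (intro mod_less) auto
  finally show ?thesis using True by (simp add: cdist_def)
next
  case False
  then show ?thesis using assms by (auto simp: cdist_def)
qed

lemma cdist_less: "a \<in> {1..n} \<Longrightarrow> b \<in> {1..n} \<Longrightarrow> cdist n a b < n"
  by (simp add: cdist_def)

lemma cdist_self [simp]: "cdist n a a = 0"
  by (simp add: cdist_def)

lemma cdist_eq_0_iff:
  "a \<in> {1..n} \<Longrightarrow> b \<in> {1..n} \<Longrightarrow> cdist n a b = 0 \<longleftrightarrow> a = b"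
  by (auto simp: cdist_eq split: if_splits)

text \<open>
  Clockwise distances from a single origin determine all of them, which turns statements about the
  cyclic order into linear arithmetic.
\<close>

lemma cdist_change_origin:
  assumes "j \<in> {1..n}" "a \<in> {1..n}" "b \<in> {1..n}"
  shows "cdist n a b = (if cdist n j a \<le> cdist n j b then cdist n j b - cdist n j a
                        else cdist n j b + n - cdist n j a)"
  using assms by (auto simp: cdist_eq split: if_splits)

lemma cdist_inj:
  "j \<in> {1..n} \<Longrightarrow> a \<in> {1..n} \<Longrightarrow> b \<in> {1..n} \<Longrightarrow> cdist n j a = cdist n j b \<longleftrightarrow> a = b"
  by (auto simp: cdist_eq split: if_splits)

text \<open>
  The successor is undefined (an arbitrary value) when \<open>S\<close> has no element other than \<open>x\<close>.
\<close>

definition csucc :: "nat \<Rightarrow> nat set \<Rightarrow> nat \<Rightarrow> nat" where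
  "csucc n S x = arg_min_on (cdist n x) (S - {x})"

text \<open>
  The half-open arc \<open>[a, b)\<close> of \<open>S\<close>; it is empty for \<open>a = b\<close>.
\<close>

definition arc :: "nat \<Rightarrow> nat set \<Rightarrow> nat \<Rightarrow> nat \<Rightarrow> nat set" where
  "arc n S a b = {x \<in> S. cdist n a x < cdist n a b}"

text \<open>
  The last points of the maximal intervals of \<open>I\<close> in the cyclic order of \<open>S\<close>.
\<close>

definition terminals :: "nat \<Rightarrow> nat set \<Rightarrow> nat set \<Rightarrow> nat set" where
  "terminals n S I = {x \<in> I. csucc n S x \<notin> I}"

lemma csucc_props:
  assumes "S \<subseteq> {1..n}" "y \<in> S" "y \<noteq> x"
  shows csucc_in: "csucc n S x \<in> S" and csucc_neq: "csucc n S x \<noteq> x"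
    and csucc_least: "cdist n x (csucc n S x) \<le> cdist n x y"
proof -
  have fin: "finite (S - {x})" using assms(1) finite_subset by auto
  moreover have "S - {x} \<noteq> {}" using assms by auto
  ultimately have "csucc n S x \<in> S - {x}"
    unfolding csucc_def by (rule arg_min_if_finite(1))
  then show "csucc n S x \<in> S" "csucc n S x \<noteq> x" by auto
  show "cdist n x (csucc n S x) \<le> cdist n x y"
    unfolding csucc_def using fin assms by (intro arg_min_least) auto
qed

lemma csucc_eqI:
  assumes "S \<subseteq> {1..n}" "x \<in> {1..n}" "z \<in> S" "z \<noteq> x"
    and "\<And>y. y \<in> S \<Longrightarrow> y \<noteq> x \<Longrightarrow> cdist n x z \<le> cdist n x y"
  shows "csucc n S x = z"
proof -
  note p = csucc_props[OF assms(1,3,4)]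
  have "cdist n x (csucc n S x) = cdist n x z"
    using p assms(5)[OF p(1,2)] by simp
  then show ?thesis using cdist_inj assms p by (meson subsetD)
qed

lemma arc_step:
  assumes "S \<subseteq> {1..n}" "a \<in> S" "b \<in> S" "a \<noteq> b"
  shows "arc n S a b = insert a (arc n S (csucc n S a) b)"
    and "a \<notin> arc n S (csucc n S a) b"
    and "cdist n (csucc n S a) b < cdist n a b"
proof -
  let ?c = "csucc n S a"
  note p = csucc_props[OF assms(1,3) assms(4)[symmetric]]
  have an: "a \<in> {1..n}" and bn: "b \<in> {1..n}" and cn: "?c \<in> {1..n}" using assms p by auto
  have pos: "0 < cdist n a ?c" using cdist_eq_0_iff[OF an cn] p by auto
  have d: "cdist n ?c x = (if x = a then n - cdist n a ?c else cdist n a x - cdist n a ?c)"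
    and d': "x \<noteq> a \<Longrightarrow> cdist n a ?c \<le> cdist n a x" if "x \<in> S" for x
  proof -
    have xn: "x \<in> {1..n}" using that assms by auto
    show l: "x \<noteq> a \<Longrightarrow> cdist n a ?c \<le> cdist n a x" using csucc_least[OF assms(1) that] .
    show "cdist n ?c x = (if x = a then n - cdist n a ?c else cdist n a x - cdist n a ?c)"
      using cdist_change_origin[OF an cn xn] l pos by auto
  qed
  have bl: "cdist n a b < n" using cdist_less an bn by simp
  have cl: "cdist n a ?c \<le> cdist n a b" using p by simp
  show "arc n S a b = insert a (arc n S ?c b)"
  proof (rule set_eqI)
    fix x show "x \<in> arc n S a b \<longleftrightarrow> x \<in> insert a (arc n S ?c b)"
    proof (cases "x \<in> S \<and> x \<noteq> a")
      case True
      then show ?thesis using d[of x] d[OF assms(3)] d'[of x] assms(4) cl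
        by (auto simp: arc_def)
    next
      case False
      then show ?thesis using assms pos cl by (auto simp: arc_def)
    qed
  qed
  show "a \<notin> arc n S ?c b"
    using d[OF assms(2)] d[OF assms(3)] bl assms(4) by (auto simp: arc_def)
  show "cdist n ?c b < cdist n a b" using d[OF assms(3)] pos cl assms(4) by auto
qed

lemma arc_iff:
  assumes "S \<subseteq> {1..n}" "o_pt \<in> {1..n}" "a \<in> S" "b \<in> S" "cdist n o_pt a \<le> cdist n o_pt b"
  shows "x \<in> arc n S a b \<longleftrightarrow> x \<in> S \<and> cdist n o_pt a \<le> cdist n o_pt x \<and> cdist n o_pt x < cdist n o_pt b"
proof (cases "x \<in> S")
  case True
  then have "a \<in> {1..n}" "x \<in> {1..n}" "b \<in> {1..n}" using assms by auto
  then show ?thesis using True assms(5) cdist_change_origin[OF assms(2), of a x]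
    cdist_change_origin[OF assms(2), of a b] cdist_less[OF assms(2), of b] cdist_less[OF assms(2), of a]
    by (auto simp: arc_def)
qed (simp add: arc_def)

lemma arc_to_origin_iff:
  assumes "S \<subseteq> {1..n}" "a \<in> S" "b \<in> S" "a \<noteq> b"
  shows "x \<in> arc n S b a \<longleftrightarrow> x \<in> S \<and> cdist n a b \<le> cdist n a x"
proof (cases "x \<in> S")
  case True
  then have i: "a \<in> {1..n}" "x \<in> {1..n}" "b \<in> {1..n}" using assms by auto
  then show ?thesis using True cdist_change_origin[OF i(1) i(3) i(2)]
    cdist_change_origin[OF i(1) i(3) i(1)] cdist_less[OF i(1) i(2)] cdist_less[OF i(1) i(3)]
    cdist_eq_0_iff[OF i(1) i(3)] assms(4)
    by (auto simp: arc_def)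
qed (simp add: arc_def)

lemma sum_arc_telescope:
  fixes f :: "nat \<Rightarrow> 'a::ab_group_add"
  assumes "S \<subseteq> {1..n}" "a \<in> S" "b \<in> S"
  shows "(\<Sum>x\<in>arc n S a b. f x - f (csucc n S x)) = f a - f b"
  using assms(2)
proof (induction "cdist n a b" arbitrary: a rule: less_induct)
  case less
  have fin: "finite (arc n S c b)" for c
    using assms(1) finite_subset unfolding arc_def by fastforce
  show ?case
  proof (cases "a = b")
    case True
    then show ?thesis by (simp add: arc_def)
  next
    case False
    note s = arc_step[OF assms(1) less(2) assms(3) False]
    have "csucc n S a \<in> S" using csucc_in[OF assms(1,3)] False by auto
    from less(1)[OF s(3) this] show ?thesis
      by (simp add: s(1,2) fin)
  qed
qed

text \<open>
  Walking from inside \<open>I\<close> to outside \<open>I\<close> passes a terminal point: the telescoped indicator function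
  of \<open>I\<close> drops by one along the arc, so it drops at some step.
\<close>

lemma arc_exit:
  assumes "S \<subseteq> {1..n}" "a \<in> S" "b \<in> S" "a \<in> I" "b \<notin> I"
  obtains y where "y \<in> arc n S a b" "y \<in> terminals n S I"
proof -
  let ?f = "\<lambda>x. if x \<in> I then 1 else (0::int)"
  have "(\<Sum>x\<in>arc n S a b. ?f x - ?f (csucc n S x)) = 1"
    using sum_arc_telescope[OF assms(1-3), of ?f] assms(4,5) by simp
  then have "\<not> (\<forall>x\<in>arc n S a b. ?f x - ?f (csucc n S x) \<le> 0)"
    using sum_nonpos[of "arc n S a b" "\<lambda>x. ?f x - ?f (csucc n S x)"] by fastforce
  then obtain y where "y \<in> arc n S a b" "y \<in> I" "csucc n S y \<notin> I"
    by (auto split: if_splits)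
  then show thesis using that by (auto simp: terminals_def)
qed

text \<open>
  A set with a single terminal point \<open>t\<close> is an interval: it starts at the first element \<open>s\<close> of \<open>I\<close>
  after \<open>t\<close>, and a gap between \<open>s\<close> and \<open>t\<close> would force another terminal point.
\<close>

lemma two_terminals_if_not_interval:
  assumes S: "S \<subseteq> {1..n}" and I: "I \<subseteq> S" "I \<noteq> {}" and nf: "\<not> cyclic_interval n S I"
  obtains s t where "s \<in> terminals n S I" "t \<in> terminals n S I" "s \<noteq> t"
proof -
  obtain i where i: "i \<in> I" using I by auto
  have "I \<noteq> S"
  proof
    assume "I = S"
    then have "I = {x \<in> S. cdist n i x < n}" using cdist_less S I i by blast
    then show False using nf S I i unfolding cyclic_interval_def by blast
  qed
  then obtain b where b: "b \<in> S" "b \<notin> I" using I by auto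
  obtain t where t: "t \<in> terminals n S I" using arc_exit[OF S _ b(1) i b(2)] I i by blast
  then have tI: "t \<in> I" "t \<in> S" "t \<in> {1..n}" and tI': "csucc n S t \<notin> I"
    using I S by (auto simp: terminals_def)
  let ?u = "csucc n S t"
  have "b \<noteq> t" using b tI by auto
  then have u: "?u \<in> S" using csucc_in[OF S b(1)] by auto
  then have un: "?u \<in> {1..n}" using S by auto
  have finI: "finite I" using I S finite_subset by (meson finite_atLeastAtMost)
  define s where "s = arg_min_on (cdist n ?u) I"
  have sI: "s \<in> I" using arg_min_if_finite(1)[OF finI I(2)] s_def by metis
  have sl: "cdist n ?u s \<le> cdist n ?u x" if "x \<in> I" for x
    using arg_min_least[OF finI I(2) that] s_def by metis
  have sn: "s \<in> {1..n}" "s \<in> S" using sI I S by auto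
  have tmax: "cdist n ?u x \<le> cdist n ?u t" if "x \<in> S" for x
  proof (cases "x = t")
    case False
    have xn: "x \<in> {1..n}" using that S by auto
    have "cdist n t ?u \<le> cdist n t x" "?u \<noteq> t" using csucc_props[OF S that] False by auto
    moreover have "cdist n t x < n" using cdist_less tI xn by auto
    moreover have "cdist n t ?u \<noteq> 0" using cdist_eq_0_iff[OF tI(3) un] \<open>?u \<noteq> t\<close> by auto
    ultimately show ?thesis
      using cdist_change_origin[OF tI(3) un xn] cdist_change_origin[OF tI(3) un tI(3)] by auto
  qed simp
  have "I \<noteq> {x \<in> S. cdist n s x < cdist n s t + 1}"
    using nf sn unfolding cyclic_interval_def by blast
  moreover have "I \<subseteq> {x \<in> S. cdist n s x < cdist n s t + 1}"
  proof
    fix x assume x: "x \<in> I"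
    then have xn: "x \<in> {1..n}" "x \<in> S" using I S by auto
    show "x \<in> {x \<in> S. cdist n s x < cdist n s t + 1}"
      using cdist_change_origin[OF un sn(1) xn(1)] cdist_change_origin[OF un sn(1) tI(3)]
        sl[OF x] tmax[OF xn(2)] sl[OF tI(1)] xn by auto
  qed
  ultimately obtain x where x: "x \<in> S" "cdist n s x \<le> cdist n s t" "x \<notin> I" by fastforce
  \<comment> \<open>The gap at \<open>x\<close> forces a terminal point before \<open>x\<close>, hence different from \<open>t\<close>.\<close>
  obtain y where "y \<in> arc n S s x" "y \<in> terminals n S I"
    using arc_exit[OF S sn(2) x(1) sI x(3)] .
  moreover have "y \<noteq> t" using calculation x by (auto simp: arc_def)
  ultimately show thesis using that t by blast
qed

text \<open>
  Seen from an origin \<open>j\<close> of \<open>S\<close>, the successor is the next larger element, except that the last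
  element wraps around to \<open>j\<close>.
\<close>

lemma csucc_cases:
  assumes "S \<subseteq> {1..n}" "j \<in> S" "x \<in> S" "y0 \<in> S" "y0 \<noteq> x"
  shows "(csucc n S x = j \<and> (\<forall>y\<in>S. cdist n j y \<le> cdist n j x)) \<or>
         (cdist n j x < cdist n j (csucc n S x) \<and>
           (\<forall>y\<in>S. cdist n j x < cdist n j y \<longrightarrow> cdist n j (csucc n S x) \<le> cdist n j y))"
proof -
  let ?c = "csucc n S x"
  note p = csucc_props[OF assms(1,4,5)]
  have jn: "j \<in> {1..n}" and xn: "x \<in> {1..n}" and cn: "?c \<in> {1..n}" using assms p by auto
  have dist: "cdist n x y = (if cdist n j x \<le> cdist n j y then cdist n j y - cdist n j x
                        else cdist n j y + n - cdist n j x)" "cdist n j y < n" if "y \<in> S" for y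
    using cdist_change_origin[OF jn xn, of y] cdist_less[OF jn, of y] that assms(1) by auto
  have neq: "cdist n j ?c \<noteq> cdist n j x" using cdist_inj[OF jn cn xn] p by auto
  note l = csucc_least[OF assms(1)]
  note dc = dist[OF p(1)]
  show ?thesis
  proof (cases "cdist n j x < cdist n j ?c")
    case True
    have "cdist n j ?c \<le> cdist n j y" if "y \<in> S" "cdist n j x < cdist n j y" for y
    proof -
      have "y \<noteq> x" using that by auto
      from l[OF that(1) this] show ?thesis using dist[OF that(1)] dc that True by simp
    qed
    then show ?thesis using True by auto
  next
    case False
    then have lt: "cdist n j ?c < cdist n j x" using neq by simp
    then have "j \<noteq> x" by auto
    have xl: "cdist n j x < n" using cdist_less[OF jn xn] .
    from l[OF assms(2) \<open>j \<noteq> x\<close>] have "cdist n j ?c = 0"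
      using dist[OF assms(2)] dc lt xl by (auto split: if_splits)
    then have cj: "?c = j" using cdist_eq_0_iff[OF jn cn] by auto
    have "cdist n j y \<le> cdist n j x" if "y \<in> S" for y
    proof (rule ccontr)
      assume a: "\<not> ?thesis"
      then have "y \<noteq> x" by auto
      from l[OF that this] show False using dist[OF that] dc lt a by simp
    qed
    then show ?thesis using cj by auto
  qed
qed

lemma cyc4_rotate: "cyc4 n a b c d \<Longrightarrow> cyc4 n b c d a"
  using cdist_change_origin[of a n b a] cdist_change_origin[of a n b c] cdist_change_origin[of a n b d]
    cdist_less[of a n d] cdist_less[of a n b] unfolding cyc4_def by auto

section \<open>Coefficients of blades\<close>

text \<open>
  Over a set \<open>T\<close> of commuting moves, this is the iterated difference of \<open>h\<close>, one difference for each
  element of \<open>T\<close>; \<open>alt_sum_insert\<close> splits off one of them.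
\<close>

definition alt_sum :: "'a set \<Rightarrow> ('a set \<Rightarrow> real) \<Rightarrow> real" where
  "alt_sum T h = (\<Sum>N\<in>Pow T. (-1) ^ card N * h N)"

lemma alt_sum_cong:
  "(\<And>N. N \<subseteq> T \<Longrightarrow> g N = h N) \<Longrightarrow> alt_sum T g = alt_sum T h"
  unfolding alt_sum_def by (intro sum.cong) auto

lemma alt_sum_diff: "alt_sum T (\<lambda>N. g N - h N) = alt_sum T g - alt_sum T h"
  unfolding alt_sum_def by (simp add: right_diff_distrib sum_subtractf)

lemma alt_sum_zero: "alt_sum T (\<lambda>N. 0) = 0"
  unfolding alt_sum_def by simp

lemma alt_sum_empty [simp]: "alt_sum {} h = h {}"
  unfolding alt_sum_def by simp

lemma alt_sum_insert:
  assumes "finite T" "x \<notin> T"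
  shows "alt_sum (insert x T) h = alt_sum T h - alt_sum T (\<lambda>N. h (insert x N))"
proof -
  have inj: "inj_on (insert x) (Pow T)"
    using assms(2) by (intro inj_onI) (metis PowD insert_ident subsetD)
  have "alt_sum (insert x T) h
      = alt_sum T h + (\<Sum>N\<in>insert x ` Pow T. (-1) ^ card N * h N)"
    unfolding alt_sum_def Pow_insert using assms by (intro sum.union_disjoint) auto
  also have "(\<Sum>N\<in>insert x ` Pow T. (-1) ^ card N * h N)
      = (\<Sum>N\<in>Pow T. (-1) ^ card (insert x N) * h (insert x N))"
    by (simp add: sum.reindex[OF inj])
  also have "\<dots> = (\<Sum>N\<in>Pow T. - ((-1) ^ card N * h (insert x N)))"
  proof (rule sum.cong[OF refl])
    fix N assume "N \<in> Pow T"
    then have "x \<notin> N" "finite N" using assms finite_subset by auto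
    then show "(-1) ^ card (insert x N) * h (insert x N) = - ((-1) ^ card N * h (insert x N))"
      by simp
  qed
  also have "\<dots> = - alt_sum T (\<lambda>N. h (insert x N))"
    unfolding alt_sum_def by (simp add: sum_negf)
  finally show ?thesis by simp
qed

text \<open>
  All elements of \<open>N\<close> advance one step at the same time. For a set \<open>N\<close> of terminal points they land
  outside \<open>I\<close>, so the cardinality is preserved.
\<close>

definition shift :: "nat \<Rightarrow> nat set \<Rightarrow> nat set \<Rightarrow> nat set \<Rightarrow> nat set" where
  "shift n S I N = (I - N) \<union> csucc n S ` N"

text \<open>
  The coefficient of \<open>\<beta>\<^sub>I\<close> in the image of \<open>f\<close> under the analogue of \<open>\<Phi>\<close> for the cyclic order of
  \<open>S\<close>.
\<close>

definition blade_coeff :: "nat \<Rightarrow> nat set \<Rightarrow> (nat set \<Rightarrow> real) \<Rightarrow> nat set \<Rightarrow> real" where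
  "blade_coeff n S f I = - alt_sum (terminals n S I) (\<lambda>N. f (shift n S I N))"

text \<open>
  The left side is a coefficient of a boundary \<open>\<partial>\<^sub>j\<close>, the right side the coefficient for the
  restriction of \<open>f\<close> to sets containing \<open>j\<close>. Let \<open>q\<close> be the last and \<open>p\<close> the first element of \<open>I\<close> as
  seen from \<open>j\<close>. The terminal points other than \<open>q\<close> and \<open>l\<close>, and their successors, depend neither on \<open>l\<close>
  nor on the removal of \<open>j\<close> from \<open>S\<close>. Summing them out leaves a function \<open>G\<close> of the places of \<open>q\<close>
  and \<open>l\<close>, and the sum over \<open>l\<close> telescopes to at most two values of \<open>G\<close>, those with \<open>l = j\<close>.
\<close>

lemma sum_blade_coeff_insert:
  assumes S: "S \<subseteq> {1..n}" and j: "j \<in> S" and I: "I \<subseteq> S - {j}" and card: "card I \<ge> 2"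
    and p: "p = next_in n j I"
  shows "(\<Sum>l\<in>arc n S j p. blade_coeff n S f (insert l I))
       = blade_coeff n (S - {j}) (\<lambda>K. f (insert j K)) I"
proof -
  define d where "d = cdist n j"
  define s where "s = csucc n S"
  have jn: "j \<in> {1..n}" using S j by auto
  have finI: "finite I" using card by (metis card.infinite not_numeral_le_zero)
  have Ine: "I \<noteq> {}" using card by auto
  have jI: "j \<notin> I" using I by auto
  have pI: "p \<in> I" and pl: "\<And>x. x \<in> I \<Longrightarrow> d p \<le> d x"
    using arg_min_if_finite(1)[OF finI Ine, of d] arg_min_least[OF finI Ine, of _ d] p jI
    by (auto simp: next_in_def d_def)
  obtain q where qI: "q \<in> I" and ql: "\<And>x. x \<in> I \<Longrightarrow> d x \<le> d q"
  proof -
    have "Max (d ` I) \<in> d ` I" using finI Ine by (intro Max_in) auto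
    then obtain q where "q \<in> I" "d q = Max (d ` I)" by auto
    then show thesis using that finI by simp
  qed
  have dinj: "x = y" if "d x = d y" "x \<in> S" "y \<in> S" for x y
    using cdist_inj[OF jn subsetD[OF S that(2)] subsetD[OF S that(3)]] that(1) d_def by simp
  have dj: "d j = 0" by (simp add: d_def)
  have dpos: "0 < d x" if "x \<in> S" "x \<noteq> j" for x
    using dinj[of x j] that j dj by auto
  have IS: "x \<in> S" if "x \<in> I" for x using I that by auto
  have pq: "p \<noteq> q"
  proof
    assume "p = q"
    then have "x = p" if "x \<in> I" for x using pl[OF that] ql[OF that] dinj[OF _ IS[OF that] IS[OF pI]] \<open>p = q\<close> by simp
    then have "I = {p}" using pI by blast
    then show False using card by simp
  qed
  have dpq: "d p < d q" using pl[OF qI] pq dinj[OF _ IS[OF pI] IS[OF qI]] by (cases "d p = d q") auto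
  have pj: "p \<noteq> j" and qj: "q \<noteq> j" using pI qI jI by auto
  have other: "\<exists>y\<in>S. y \<noteq> x" for x using j pj IS[OF pI] by (cases "x = j") auto
  have C: "(s x = j \<and> (\<forall>y\<in>S. d y \<le> d x)) \<or>
        (d x < d (s x) \<and> (\<forall>y\<in>S. d x < d y \<longrightarrow> d (s x) \<le> d y))" if "x \<in> S" for x
    using csucc_cases[OF S j that] other[of x] unfolding s_def d_def by fast
  have sS: "s x \<in> S" "s x \<noteq> x" for x using csucc_in[OF S] csucc_neq[OF S] other[of x] s_def by auto
  have A1: "d x < d (s x)" "d (s x) \<le> d q" if "x \<in> I" "x \<noteq> q" for x
  proof -
    have "d x < d q" using ql[OF that(1)] that(2) dinj[OF _ IS[OF that(1)] IS[OF qI]] by (cases "d x = d q") auto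
    then show "d x < d (s x)" "d (s x) \<le> d q"
      using C[OF IS[OF that(1)]] IS[OF qI] by auto
  qed
  have A2: "d l < d (s l)" "d (s l) \<le> d p" if "l \<in> S" "d l < d p" for l
    using C[OF that(1)] that(2) IS[OF pI] by auto
  have A3: "s q = j \<or> d q < d (s q)" using C[OF IS[OF qI]] by auto
  have sqI: "s q \<notin> I" using A3 jI ql by force
  define T0 where "T0 = {x \<in> I - {q}. s x \<notin> I}"
  have finT0: "finite T0" using finI T0_def by auto
  have qT0: "q \<notin> T0" by (simp add: T0_def)
  define G where "G u v = alt_sum T0 (\<lambda>N. f (shift n S (I - {q}) N \<union> {u, v}))" for u v
  \<comment> \<open>In \<open>I \<union> {l}\<close> the point \<open>q\<close> is blocked when its successor is \<open>l\<close>, and \<open>l\<close> when its successor is \<open>p\<close>.\<close>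
  have coeff: "blade_coeff n S f (insert l I) =
      - (G q l - (if s q = l then 0 else G (s q) l) - (if s l = p then 0 else G q (s l))
          + (if s q = l \<or> s l = p then 0 else G (s q) (s l)))"
    if l: "l \<in> S" "d l < d p" for l
  proof -
    have lI: "l \<notin> I" using pl l by force
    have lq: "l \<noteq> q" using lI qI by auto
    have slI: "s l \<in> insert l I \<longleftrightarrow> s l = p"
      using A2[OF l] pl[of "s l"] pI dinj[OF _ sS(1) IS[OF pI]] sS(2) by auto
    have T: "terminals n S (insert l I)
        = (if s q = l then {} else {q}) \<union> (if s l = p then {} else {l}) \<union> T0"
    proof (rule set_eqI)
      fix x
      consider "x = l" | "x = q" | "x \<in> I" "x \<noteq> q" "x \<noteq> l" | "x \<notin> insert l I" by auto
      then show "x \<in> terminals n S (insert l I) \<longleftrightarrow> x \<in> (if s q = l then {} else {q}) \<union>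
          (if s l = p then {} else {l}) \<union> T0"
      proof cases
        case 1
        then show ?thesis using slI lI lq by (auto simp: terminals_def T0_def s_def)
      next
        case 2
        then show ?thesis using sqI lq qI lI by (auto simp: terminals_def T0_def s_def)
      next
        case 3
        have "s x \<noteq> l" using A1[OF 3(1,2)] pl[OF 3(1)] l(2) by auto
        then show ?thesis using 3 by (auto simp: terminals_def T0_def s_def)
      next
        case 4
        then show ?thesis using qI by (auto simp: terminals_def T0_def)
      qed
    qed
    define h where "h N = f (shift n S (insert l I) N)" for N
    have h: "h N = f (shift n S (I - {q}) N \<union> {q, l})"
       "h (insert q N) = f (shift n S (I - {q}) N \<union> {s q, l})"
       "h (insert l N) = f (shift n S (I - {q}) N \<union> {q, s l})"
       "h (insert q (insert l N)) = f (shift n S (I - {q}) N \<union> {s q, s l})"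
       "h (insert l (insert q N)) = f (shift n S (I - {q}) N \<union> {s q, s l})"
       if N: "N \<subseteq> T0" for N
    proof -
      have n: "q \<notin> N" "l \<notin> N" using N lI by (auto simp: T0_def)
      show "h N = f (shift n S (I - {q}) N \<union> {q, l})"
        unfolding h_def by (rule arg_cong[of _ _ f]) (use n qI in \<open>auto simp: shift_def s_def\<close>)
      show "h (insert q N) = f (shift n S (I - {q}) N \<union> {s q, l})"
        unfolding h_def by (rule arg_cong[of _ _ f]) (use n lq in \<open>auto simp: shift_def s_def\<close>)
      show "h (insert l N) = f (shift n S (I - {q}) N \<union> {q, s l})"
        unfolding h_def by (rule arg_cong[of _ _ f]) (use n lI lq qI in \<open>auto simp: shift_def s_def\<close>)
      show "h (insert q (insert l N)) = f (shift n S (I - {q}) N \<union> {s q, s l})"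
        unfolding h_def by (rule arg_cong[of _ _ f]) (use n lI lq in \<open>auto simp: shift_def s_def\<close>)
      then show "h (insert l (insert q N)) = f (shift n S (I - {q}) N \<union> {s q, s l})"
        by (simp add: insert_commute)
    qed
    have lT0: "l \<notin> T0" using lI by (simp add: T0_def)
    have e: "alt_sum T0 h = G q l" "alt_sum T0 (\<lambda>N. h (insert q N)) = G (s q) l"
        "alt_sum T0 (\<lambda>N. h (insert l N)) = G q (s l)"
        "alt_sum T0 (\<lambda>N. h (insert q (insert l N))) = G (s q) (s l)"
        "alt_sum T0 (\<lambda>N. h (insert l (insert q N))) = G (s q) (s l)"
      unfolding G_def using h by (auto intro: alt_sum_cong)
    have "alt_sum (terminals n S (insert l I)) h =
      G q l - (if s q = l then 0 else G (s q) l) - (if s l = p then 0 else G q (s l))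
          + (if s q = l \<or> s l = p then 0 else G (s q) (s l))"
      unfolding T using finT0 qT0 lT0 lq by (auto simp: alt_sum_insert e)
    then show ?thesis unfolding blade_coeff_def h_def[symmetric] by simp
  qed
  \<comment> \<open>Removing \<open>j\<close> changes only the successor of the predecessor of \<open>j\<close>; in \<open>I\<close> this can only be \<open>q\<close>.\<close>
  define s' where "s' = csucc n (S - {j})"
  have S': "S - {j} \<subseteq> {1..n}" using S by auto
  have s'eq: "s' x = s x" if "x \<in> S" "s x \<noteq> j" for x
    unfolding s'_def using that S sS[of x] csucc_least[OF S, of _ x]
    by (intro csucc_eqI[OF S']) (auto simp: s_def)
  have s'q: "s' q = s j" if sq: "s q = j"
    unfolding s'_def
  proof (rule csucc_eqI[OF S'])
    show "q \<in> {1..n}" using IS[OF qI] S by auto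
    have "d (s j) \<le> d p" using A2(2)[OF j] dj dpos[OF IS[OF pI] pj] by simp
    then have sjq: "d (s j) < d q" using dpq by simp
    then show "s j \<noteq> q" by auto
    show "s j \<in> S - {j}" using sS[of j] by auto
    fix y assume y: "y \<in> S - {j}" "y \<noteq> q"
    have "\<forall>y\<in>S. d y \<le> d q" using C[OF IS[OF qI]]
    proof
      assume "d q < d (s q) \<and> (\<forall>y\<in>S. d q < d y \<longrightarrow> d (s q) \<le> d y)"
      then show ?thesis using sq dj by simp
    qed simp
    then have "d y < d q" using y dinj[OF _ _ IS[OF qI], of y] by (cases "d y = d q") auto
    moreover have "d (s j) \<le> d y" using C[OF j] dpos[of y] y dj by fastforce
    moreover have "q \<in> {1..n}" "s j \<in> {1..n}" "y \<in> {1..n}"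
      using IS[OF qI] sS(1)[of j] y S by auto
    ultimately show "cdist n q (s j) \<le> cdist n q y"
      using cdist_change_origin[OF jn, of q "s j"] cdist_change_origin[OF jn, of q y] sjq
      unfolding d_def by simp
  qed
  have s'I: "s' x = s x" if "x \<in> I" "x \<noteq> q" for x
    using s'eq[OF IS[OF that(1)]] A1(1)[OF that] dj by (cases "s x = j") auto
  have s'qI: "s' q \<in> I \<longleftrightarrow> s q = j \<and> s j = p"
  proof (cases "s q = j")
    case True
    have "d (s j) \<le> d p" using A2(2)[OF j] dj dpos[OF IS[OF pI] pj] by simp
    then have "s j \<in> I \<longleftrightarrow> s j = p"
      using pl[of "s j"] pI dinj[OF _ sS(1)[of j] IS[OF pI]] by (cases "d (s j) = d p") auto
    then show ?thesis using True s'q by simp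
  next
    case False
    then show ?thesis using s'eq[OF IS[OF qI]] sqI by simp
  qed
  have T': "terminals n (S - {j}) I = (if s' q \<in> I then {} else {q}) \<union> T0"
  proof (rule set_eqI)
    fix x show "x \<in> terminals n (S - {j}) I \<longleftrightarrow> x \<in> (if s' q \<in> I then {} else {q}) \<union> T0"
      using qI s'I[of x] by (cases "x = q") (auto simp: terminals_def T0_def s'_def)
  qed
  have rhs: "blade_coeff n (S - {j}) (\<lambda>K. f (insert j K)) I
      = - (G q j - (if s' q \<in> I then 0 else G (s' q) j))"
  proof -
    define h where "h N = f (insert j (shift n (S - {j}) I N))" for N
    have h: "h N = f (shift n S (I - {q}) N \<union> {q, j})"
       "h (insert q N) = f (shift n S (I - {q}) N \<union> {s' q, j})" if N: "N \<subseteq> T0" for N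
    proof -
      have n: "q \<notin> N" using N by (auto simp: T0_def)
      have im: "csucc n (S - {j}) ` N = csucc n S ` N"
        using s'I N by (intro image_cong) (auto simp: s'_def s_def T0_def)
      show "h N = f (shift n S (I - {q}) N \<union> {q, j})"
        unfolding h_def by (rule arg_cong[of _ _ f]) (use n qI im in \<open>auto simp: shift_def\<close>)
      show "h (insert q N) = f (shift n S (I - {q}) N \<union> {s' q, j})"
        unfolding h_def by (rule arg_cong[of _ _ f]) (use n im in \<open>auto simp: shift_def s'_def\<close>)
    qed
    have e: "alt_sum T0 h = G q j" "alt_sum T0 (\<lambda>N. h (insert q N)) = G (s' q) j"
      unfolding G_def using h by (auto intro: alt_sum_cong)
    show ?thesis unfolding blade_coeff_def h_def[symmetric] T'
      using finT0 qT0 by (auto simp: alt_sum_insert e)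
  qed
  \<comment> \<open>The value \<open>0\<close> at \<open>p\<close> accounts for the last position before \<open>p\<close>, from which \<open>l\<close> cannot advance.\<close>
  define f1 where "f1 l = (if l = p then 0 else G q l)" for l
  define f2 where "f2 l = (if l = p then 0 else G (s q) l)" for l
  have pS: "p \<in> S" using IS pI by simp
  have arcj: "l \<in> arc n S j p \<longleftrightarrow> l \<in> S \<and> d l < d p" for l by (simp add: arc_def d_def)
  have t1: "(\<Sum>l\<in>arc n S j p. f1 l - f1 (s l)) = G q j"
    using sum_arc_telescope[OF S j pS, of f1] pj unfolding s_def by (simp add: f1_def)
  show ?thesis
  \<comment> \<open>If \<open>q\<close> directly precedes \<open>j\<close>, it cannot advance for \<open>l = j\<close>, and \<open>f2\<close> telescopes from the
    position after \<open>j\<close> only; the symmetry of \<open>G\<close> then identifies the two sides.\<close>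
  proof (cases "s q = j")
    case False
    have ne: "s q \<noteq> l" if "d l < d p" for l using A3 False dpq that by auto
    have "blade_coeff n S f (insert l I) = (f2 l - f2 (s l)) - (f1 l - f1 (s l))"
      if "l \<in> arc n S j p" for l
      using that ne[of l] unfolding arcj by (auto simp: coeff f1_def f2_def)
    then have "(\<Sum>l\<in>arc n S j p. blade_coeff n S f (insert l I))
       = (\<Sum>l\<in>arc n S j p. f2 l - f2 (s l)) - (\<Sum>l\<in>arc n S j p. f1 l - f1 (s l))"
      by (simp add: sum_subtractf)
    also have "(\<Sum>l\<in>arc n S j p. f2 l - f2 (s l)) = G (s q) j"
      using sum_arc_telescope[OF S j pS, of f2] pj by (simp add: f2_def s_def)
    finally show ?thesis using rhs t1 s'qI False s'eq[OF IS[OF qI] False] by simp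
  next
    case True
    have fin: "finite (arc n S j p)" using S finite_subset unfolding arc_def by fastforce
    have st: "arc n S j p = insert j (arc n S (s j) p)" "j \<notin> arc n S (s j) p"
      using arc_step[OF S j pS] pj unfolding s_def by auto
    have "blade_coeff n S f (insert l I) = (if l = j then 0 else f2 l - f2 (s l)) - (f1 l - f1 (s l))"
      if "l \<in> arc n S j p" for l
      using that True unfolding arcj by (auto simp: coeff f1_def f2_def)
    then have "(\<Sum>l\<in>arc n S j p. blade_coeff n S f (insert l I))
       = (\<Sum>l\<in>arc n S j p. (if l = j then 0 else f2 l - f2 (s l))) - (\<Sum>l\<in>arc n S j p. f1 l - f1 (s l))"
      by (simp add: sum_subtractf)
    also have "(\<Sum>l\<in>arc n S j p. (if l = j then 0 else f2 l - f2 (s l)))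
        = (\<Sum>l\<in>arc n S (s j) p. f2 l - f2 (s l))"
      using fin st by (auto intro!: sum.cong)
    also have "\<dots> = f2 (s j)"
      using sum_arc_telescope[OF S sS(1) pS, of f2] by (simp add: f2_def s_def)
    finally have "(\<Sum>l\<in>arc n S j p. blade_coeff n S f (insert l I)) = f2 (s j) - G q j"
      using t1 by simp
    moreover have "G j (s j) = G (s j) j" unfolding G_def by (simp add: insert_commute)
    ultimately show ?thesis using rhs s'qI True s'q by (auto simp: f2_def)
  qed
qed

section \<open>The map \<open>\<Phi>\<close> and the boundary operators\<close>

lemma lookup_scaleR [simp]: "Poly_Mapping.lookup (r *\<^sub>R v) x = r * Poly_Mapping.lookup v x"
proof -
  have "finite {i. r *\<^sub>R Poly_Mapping.lookup v i \<noteq> 0}"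
    by (rule finite_subset[OF _ finite_lookup[of v]]) auto
  then show ?thesis by (simp add: scaleR_poly_mapping_def)
qed

lemma lookup_blade:
  "Poly_Mapping.lookup (blade n L J) (L', I) =
     (if nonfrozen n L J \<and> L = L' \<and> J = I then 1 else 0)"
  by (auto simp: blade_def lookup_single when_def)

lemma cyc_pred_in: "x \<in> {1..n} \<Longrightarrow> cyc_pred n x \<in> {1..n}"
  by (auto simp: cyc_pred_def)

lemma csucc_full:
  assumes "n \<ge> 2" "x \<in> {1..n}"
  shows "csucc n {1..n} x = (if x = n then 1 else x + 1)"
proof (rule csucc_eqI)
  fix y assume "y \<in> {1..n}" "y \<noteq> x"
  moreover have "(if x = n then 1 else x + 1) \<in> {1..n}" using assms by auto
  ultimately show "cdist n x (if x = n then 1 else x + 1) \<le> cdist n x y"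
    using assms by (auto simp: cdist_eq)
qed (use assms in auto)

lemma cyc_pred_csucc: "n \<ge> 2 \<Longrightarrow> x \<in> {1..n} \<Longrightarrow> cyc_pred n (csucc n {1..n} x) = x"
  by (subst csucc_full) (auto simp: cyc_pred_def)

lemma csucc_cyc_pred: "n \<ge> 2 \<Longrightarrow> x \<in> {1..n} \<Longrightarrow> csucc n {1..n} (cyc_pred n x) = x"
  by (subst csucc_full[OF _ cyc_pred_in]) (auto simp: cyc_pred_def split: if_splits)

lemma terminals_subset: "terminals n S I \<subseteq> I"
  by (auto simp: terminals_def)

lemma inj_csucc_full: "n \<ge> 2 \<Longrightarrow> inj_on (csucc n {1..n}) {1..n}"
  by (metis cyc_pred_csucc inj_onI)

lemma inj_cyc_pred: "n \<ge> 2 \<Longrightarrow> inj_on (cyc_pred n) {1..n}"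
  by (metis csucc_cyc_pred inj_onI)

text \<open>
  This and \<open>unshift_full_in\<close> say that \<open>(J, M) \<mapsto> N\<close>, with \<open>N\<close> the set of predecessors of
  the elements of \<open>M\<close>, is a bijection from the pairs with \<open>J\<^sub>M = I\<close> onto the sets of terminal points of
  \<open>I\<close>: retreating initial points of \<open>J\<close> and advancing terminal points of \<open>I\<close> undo each other.
\<close>

lemma shift_full_in:
  assumes n: "n \<ge> 2" and I: "I \<in> nsets {1..n} k" and N: "N \<subseteq> terminals n {1..n} I"
  shows "shift n {1..n} I N \<in> nsets {1..n} k"
    and "csucc n {1..n} ` N \<subseteq> initial_points n (shift n {1..n} I N)"
    and "(shift n {1..n} I N - csucc n {1..n} ` N) \<union> cyc_pred n ` (csucc n {1..n} ` N) = I"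
    and "cyc_pred n ` (csucc n {1..n} ` N) = N"
    and "card (csucc n {1..n} ` N) = card N"
proof -
  let ?s = "csucc n {1..n}"
  have IS: "I \<subseteq> {1..n}" "finite I" "card I = k" using I by (auto simp: nsets_def)
  have NI: "N \<subseteq> I" "N \<subseteq> {1..n}" using N terminals_subset IS by blast+
  have out: "?s ` N \<inter> I = {}" using N by (auto simp: terminals_def)
  have sin: "?s ` N \<subseteq> {1..n}"
  proof (rule image_subsetI)
    fix x assume "x \<in> N"
    then have "x \<in> {1..n}" using NI by auto
    then show "?s x \<in> {1..n}" using csucc_full[OF n] n by auto
  qed
  show c: "card (?s ` N) = card N"
    using card_image inj_on_subset[OF inj_csucc_full[OF n] NI(2)] by blast
  have fN: "finite N" using NI IS finite_subset by blast
  have "card ((I - N) \<union> ?s ` N) = card (I - N) + card (?s ` N)"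
    using IS fN out by (intro card_Un_disjoint) auto
  also have "\<dots> = k" using c card_Diff_subset[OF fN NI(1)] card_mono[OF IS(2) NI(1)] IS by simp
  finally show "shift n {1..n} I N \<in> nsets {1..n} k"
    using IS fN sin unfolding nsets_def shift_def by auto
  have ps: "cyc_pred n (?s x) = x" if "x \<in> N" for x using cyc_pred_csucc[OF n] that NI by auto
  show pN: "cyc_pred n ` (?s ` N) = N" using ps by force
  show "?s ` N \<subseteq> initial_points n (shift n {1..n} I N)"
  proof (rule subsetI)
    fix y assume "y \<in> ?s ` N"
    then obtain x where x: "x \<in> N" "y = ?s x" by auto
    have "x \<notin> shift n {1..n} I N" using x out NI by (auto simp: shift_def)
    then show "y \<in> initial_points n (shift n {1..n} I N)"
      using x ps[OF x(1)] by (simp add: initial_points_def shift_def)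
  qed
  show "(shift n {1..n} I N - ?s ` N) \<union> cyc_pred n ` (?s ` N) = I"
    unfolding pN using out NI by (auto simp: shift_def)
qed

lemma unshift_full_in:
  assumes n: "n \<ge> 2" and J: "J \<in> nsets {1..n} k" and M: "M \<subseteq> initial_points n J"
    and I: "I = (J - M) \<union> cyc_pred n ` M"
  shows "I \<in> nsets {1..n} k"
    and "cyc_pred n ` M \<subseteq> terminals n {1..n} I"
    and "shift n {1..n} I (cyc_pred n ` M) = J"
    and "csucc n {1..n} ` (cyc_pred n ` M) = M"
proof -
  let ?s = "csucc n {1..n}"
  have JS: "J \<subseteq> {1..n}" "finite J" "card J = k" using J by (auto simp: nsets_def)
  have MJ: "M \<subseteq> J" "M \<subseteq> {1..n}" using M JS by (auto simp: initial_points_def)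
  have out: "cyc_pred n ` M \<inter> J = {}" using M by (auto simp: initial_points_def)
  have pin: "cyc_pred n ` M \<subseteq> {1..n}" using MJ cyc_pred_in by blast
  have c: "card (cyc_pred n ` M) = card M"
    using card_image inj_on_subset[OF inj_cyc_pred[OF n] MJ(2)] by blast
  have fM: "finite M" using MJ JS finite_subset by blast
  have "card ((J - M) \<union> cyc_pred n ` M) = card (J - M) + card (cyc_pred n ` M)"
    using JS fM out by (intro card_Un_disjoint) auto
  also have "\<dots> = k" using c card_Diff_subset[OF fM MJ(1)] card_mono[OF JS(2) MJ(1)] JS by simp
  finally show "I \<in> nsets {1..n} k"
    using JS fM pin unfolding nsets_def I by auto
  have sp: "?s (cyc_pred n x) = x" if "x \<in> M" for x using csucc_cyc_pred[OF n] that MJ by blast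
  show sM: "?s ` (cyc_pred n ` M) = M" using sp by force
  show "cyc_pred n ` M \<subseteq> terminals n {1..n} I"
  proof (rule image_subsetI)
    fix x assume x: "x \<in> M"
    then have "?s (cyc_pred n x) \<notin> I" using sp[OF x] out MJ unfolding I by auto
    then show "cyc_pred n x \<in> terminals n {1..n} I" using x by (simp add: terminals_def I)
  qed
  show "shift n {1..n} I (cyc_pred n ` M) = J"
    unfolding shift_def sM using out MJ unfolding I by auto
qed

text \<open>
  Exchange of summation: the blade \<open>\<beta>\<^sub>I\<close> occurs in \<open>\<L>\<^sub>J\<close> once for every \<open>M\<close> with \<open>J\<^sub>M = I\<close>, and
  these pairs \<open>(J, M)\<close> correspond to the sets of terminal points of \<open>I\<close>.
\<close>

lemma lookup_Phi:
  assumes n: "n \<ge> 2" and I: "I \<in> nsets {1..n} k" and nf: "nonfrozen n {} I"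
  shows "Poly_Mapping.lookup (Phi k n \<pi>) ({}, I) = blade_coeff n {1..n} (Poly_Mapping.lookup \<pi>) I"
proof -
  let ?T = "terminals n {1..n} I" and ?s = "csucc n {1..n}" and ?l = "Poly_Mapping.lookup \<pi>"
  let ?D = "SIGMA J:nsets {1..n} k. Pow (initial_points n J)"
  let ?Q = "\<lambda>(J, M). (J - M) \<union> cyc_pred n ` M = I"
  have fin: "finite (nsets {1..n} k)" by (simp add: finite_imp_finite_nsets)
  have finD: "finite (Pow (initial_points n J))" if "J \<in> nsets {1..n} k" for J
    using that by (auto simp: nsets_def initial_points_def)
  have "Poly_Mapping.lookup (Phi k n \<pi>) ({}, I) =
     (\<Sum>J\<in>nsets {1..n} k. \<Sum>M\<in>Pow (initial_points n J).
        if ?Q (J, M) then ?l J * (-1) ^ (1 + card M) else 0)"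
    unfolding Phi_def L_elem_def
    by (auto simp: lookup_sum lookup_blade sum_distrib_left nf intro!: sum.cong)
  also have "\<dots> = (\<Sum>(J, M)\<in>?D. if ?Q (J, M) then ?l J * (-1) ^ (1 + card M) else 0)"
    using fin finD by (subst sum.Sigma) auto
  also have "\<dots> = (\<Sum>(J, M)\<in>{z \<in> ?D. ?Q z}. ?l J * (-1) ^ (1 + card M))"
    using fin finD by (subst sum.inter_filter) (auto intro!: finite_SigmaI sum.cong)
  also have "\<dots> = (\<Sum>N\<in>Pow ?T. - ((-1) ^ card N * ?l (shift n {1..n} I N)))"
  proof (rule sum.reindex_bij_witness[where j = "\<lambda>(J, M). cyc_pred n ` M" and
        i = "\<lambda>N. (shift n {1..n} I N, ?s ` N)"])
    fix z assume "z \<in> {z \<in> ?D. ?Q z}"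
    then obtain J M where z: "z = (J, M)" "J \<in> nsets {1..n} k" "M \<subseteq> initial_points n J"
      "I = (J - M) \<union> cyc_pred n ` M" by auto
    note u = unshift_full_in[OF n z(2-4)]
    show "(shift n {1..n} I (case z of (J, M) \<Rightarrow> cyc_pred n ` M), ?s ` (case z of (J, M) \<Rightarrow> cyc_pred n ` M)) = z"
      "(case z of (J, M) \<Rightarrow> cyc_pred n ` M) \<in> Pow ?T" using u z(1) by simp_all
    have "card (cyc_pred n ` M) = card M"
      using shift_full_in(5)[OF n u(1,2)] u(4) by simp
    then show "- ((-1) ^ card (case z of (J, M) \<Rightarrow> cyc_pred n ` M) *
        ?l (shift n {1..n} I (case z of (J, M) \<Rightarrow> cyc_pred n ` M))) =
        (case z of (J, M) \<Rightarrow> ?l J * (-1) ^ (1 + card M))"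
      using u z(1) by simp
  next
    fix N assume "N \<in> Pow ?T"
    then have "N \<subseteq> ?T" by simp
    note u = shift_full_in[OF n I this]
    show "(case (shift n {1..n} I N, ?s ` N) of (J, M) \<Rightarrow> cyc_pred n ` M) = N" using u by simp
    show "(shift n {1..n} I N, ?s ` N) \<in> {z \<in> ?D. ?Q z}" using u by simp
  qed
  also have "\<dots> = blade_coeff n {1..n} ?l I"
    unfolding blade_coeff_def alt_sum_def by (simp add: sum_negf)
  finally show ?thesis .
qed

lemma Phi_in_blade_space:
  assumes n: "n \<ge> 2"
  shows "Phi k n \<pi> \<in> blade_space k n {}"
proof -
  have "nonfrozen n {} I \<and> L = {} \<and> card I = k"
    if nz: "Poly_Mapping.lookup (Phi k n \<pi>) (L, I) \<noteq> 0" for L I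
  proof -
    have "\<exists>J\<in>nsets {1..n} k. Poly_Mapping.lookup (L_elem n J) (L, I) \<noteq> 0"
      by (rule ccontr) (use nz in \<open>auto simp: Phi_def lookup_sum\<close>)
    then obtain J where J: "J \<in> nsets {1..n} k" "Poly_Mapping.lookup (L_elem n J) (L, I) \<noteq> 0" by blast
    have "\<exists>M\<in>Pow (initial_points n J).
        Poly_Mapping.lookup (blade n {} ((J - M) \<union> cyc_pred n ` M)) (L, I) \<noteq> 0"
      by (rule ccontr) (use J in \<open>auto simp: L_elem_def lookup_sum\<close>)
    then obtain M where M: "M \<subseteq> initial_points n J"
      "nonfrozen n {} ((J - M) \<union> cyc_pred n ` M)" "L = {}" "I = (J - M) \<union> cyc_pred n ` M"
      by (auto simp: lookup_blade split: if_splits)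
    then show ?thesis using unshift_full_in(1)[OF n J(1) M(1) M(4)] by (auto simp: nsets_def)
  qed
  then show ?thesis unfolding blade_space_def
    by (auto simp: in_keys_iff)
qed

lemma linear_Phi: "linear (Phi k n)"
  unfolding Phi_def
  by (rule linearI) (simp_all add: lookup_add scaleR_add_left sum.distrib scaleR_sum_right)

lemma next_in_props:
  assumes "finite I" "I \<noteq> {}"
  shows next_in_in: "next_in n j I \<in> I"
    and next_in_least: "x \<in> I \<Longrightarrow> cdist n j (next_in n j I) \<le> cdist n j x"
  using arg_min_if_finite(1)[OF assms, of "cdist n j"] arg_min_least[OF assms, of x "cdist n j"]
  by (auto simp: next_in_def)

lemma nonfrozen_nonempty: "n \<ge> 1 \<Longrightarrow> nonfrozen n L J \<Longrightarrow> J \<noteq> {}"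
  unfolding nonfrozen_def cyclic_interval_def by force

lemma nonfrozen_finite: "nonfrozen n L J \<Longrightarrow> finite J"
  unfolding nonfrozen_def using finite_subset by auto

text \<open>
  Removing the first element after \<open>j\<close> from an interval leaves an interval of the cyclic order
  without \<open>j\<close>: if \<open>l \<noteq> j\<close>, then \<open>j\<close> lies outside the interval and \<open>l\<close> is its initial point.
\<close>

lemma nonfrozen_insert:
  assumes n: "n \<ge> 2" and j: "j \<in> {1..n} - L" and nf: "nonfrozen n (insert j L) I"
    and l: "l \<in> arc n ({1..n} - L) j (next_in n j I)"
  shows "nonfrozen n L (insert l I)"
proof -
  let ?S = "{1..n} - L"
  have IS: "I \<subseteq> ?S - {j}" using nf by (auto simp: nonfrozen_def)
  have lS: "l \<in> ?S" and lp: "cdist n j l < cdist n j (next_in n j I)" using l by (auto simp: arc_def)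
  have "\<not> cyclic_interval n ?S (insert l I)"
  proof
    assume "cyclic_interval n ?S (insert l I)"
    then obtain a m where a: "a \<in> {1..n}" and eq: "insert l I = {x \<in> ?S. cdist n a x < m}"
      unfolding cyclic_interval_def by blast
    have memI: "x \<in> insert l I \<longleftrightarrow> x \<in> ?S \<and> cdist n a x < m" for x using eq by auto
    have Inl: "l \<notin> I" using next_in_least[OF nonfrozen_finite[OF nf], of l n j] lp by force
    have "\<exists>b\<in>{1..n}. \<exists>m'. I = {x \<in> ?S - {j}. cdist n b x < m'}"
    proof (cases "l = j")
      case True
      then have "I = {x \<in> ?S - {j}. cdist n a x < m}" using eq IS by auto
      then show ?thesis using a by blast
    next
      case False
      then have "j \<notin> insert l I" using IS by auto
      then have mj: "m \<le> cdist n a j" using memI[of j] j by auto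
      have jn: "j \<in> {1..n}" and ln: "l \<in> {1..n}" using j lS by auto
      define b where "b = (if l = n then 1 else l + 1)"
      have b: "b \<in> {1..n}" using ln by (auto simp: b_def)
      have lm: "cdist n a l < m" using memI[of l] lS by auto
      have jl: "cdist n a j < n" using cdist_less a jn by auto
      have ab: "cdist n a b = cdist n a l + 1"
        using a ln b lm mj jl n by (auto simp: b_def cdist_eq split: if_splits)
      have lleast: "cdist n a l < cdist n a x" if "x \<in> I" for x
      proof -
        have xn: "x \<in> {1..n}" using that IS by auto
        have xm: "cdist n a x < m" using memI[of x] that by auto
        have "cdist n j l < cdist n j x"
          using lp next_in_least[OF nonfrozen_finite[OF nf] _ that, of n j] that by fastforce
        then show ?thesis using cdist_change_origin[OF a jn xn] cdist_change_origin[OF a jn ln]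
            xm lm mj by auto
      qed
      have "x \<in> I \<longleftrightarrow> x \<in> ?S - {j} \<and> cdist n b x < m - cdist n a l - 1" for x
      proof (cases "x \<in> ?S - {j}")
        case True
        then have xn: "x \<in> {1..n}" by auto
        have "x \<in> I \<longleftrightarrow> cdist n a l < cdist n a x \<and> cdist n a x < m"
          using memI[of x] lleast[of x] True by auto
        then show ?thesis using True cdist_change_origin[OF a b xn] ab lm mj jl by auto
      qed (use IS in auto)
      then have "I = {x \<in> ?S - {j}. cdist n b x < m - cdist n a l - 1}" by blast
      then show ?thesis using b by blast
    qed
    moreover have "?S - {j} = {1..n} - insert j L" by auto
    ultimately show False using nf unfolding nonfrozen_def cyclic_interval_def by metis
  qed
  then show ?thesis using IS lS by (auto simp: nonfrozen_def)
qed

lemma lookup_boundary: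
  assumes n: "n \<ge> 2" and j: "j \<in> {1..n} - L" and \<beta>: "\<beta> \<in> blade_space k n L"
  shows "Poly_Mapping.lookup (boundary n j \<beta>) (L', I) =
    (\<Sum>(K, J)\<in>Poly_Mapping.keys \<beta>. if nonfrozen n (insert j L) (J - {next_in n j J})
       \<and> insert j L = L' \<and> J - {next_in n j J} = I then Poly_Mapping.lookup \<beta> (L, J) else 0)"
  unfolding boundary_def lookup_sum
proof (rule sum.cong[OF refl])
  fix z assume "z \<in> Poly_Mapping.keys \<beta>"
  then obtain J where "z = (L, J)" using \<beta> by (auto simp: blade_space_def)
  then show "Poly_Mapping.lookup (case z of (L, J) \<Rightarrow> Poly_Mapping.lookup \<beta> (L, J) *\<^sub>R boundary_basis n j L J) (L', I) =
     (case z of (K, J) \<Rightarrow> if nonfrozen n (insert j L) (J - {next_in n j J})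
       \<and> insert j L = L' \<and> J - {next_in n j J} = I then Poly_Mapping.lookup \<beta> (L, J) else 0)"
    using j by (auto simp: boundary_basis_def lookup_blade)
qed

lemma boundary_in_blade_space:
  assumes n: "n \<ge> 2" and L: "L \<subseteq> {1..n}" and j: "j \<in> {1..n} - L" and \<beta>: "\<beta> \<in> blade_space k n L"
  shows "boundary n j \<beta> \<in> blade_space k n (insert j L)"
proof -
  have "nonfrozen n (insert j L) I \<and> L' = insert j L \<and> card I + card (insert j L) = k"
    if nz: "Poly_Mapping.lookup (boundary n j \<beta>) (L', I) \<noteq> 0" for L' I
  proof -
    have "\<exists>(K, J)\<in>Poly_Mapping.keys \<beta>. nonfrozen n (insert j L) (J - {next_in n j J})
       \<and> insert j L = L' \<and> J - {next_in n j J} = I"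
    proof (rule ccontr)
      assume no: "\<not> ?thesis"
      have "Poly_Mapping.lookup (boundary n j \<beta>) (L', I) = 0"
        unfolding lookup_boundary[OF n j \<beta>]
      proof (intro sum.neutral ballI)
        fix z assume z: "z \<in> Poly_Mapping.keys \<beta>"
        obtain K J where zKJ: "z = (K, J)" by (cases z)
        have "\<not> (nonfrozen n (insert j L) (J - {next_in n j J})
            \<and> insert j L = L' \<and> J - {next_in n j J} = I)" using no z zKJ by blast
        then show "(case z of (K, J) \<Rightarrow> if nonfrozen n (insert j L) (J - {next_in n j J})
            \<and> insert j L = L' \<and> J - {next_in n j J} = I then Poly_Mapping.lookup \<beta> (L, J) else 0) = 0"
          unfolding zKJ prod.case by (rule if_not_P)
      qed
      then show False using nz by simp
    qed
    then obtain K J where J: "(K, J) \<in> Poly_Mapping.keys \<beta>"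
      "nonfrozen n (insert j L) I" "L' = insert j L" "I = J - {next_in n j J}" by auto
    have J': "nonfrozen n L J" "card J + card L = k" using J(1) \<beta> by (auto simp: blade_space_def)
    have "finite J" "J \<noteq> {}" using nonfrozen_finite[OF J'(1)] nonfrozen_nonempty[OF _ J'(1)] n by auto
    then have "card I + 1 = card J" using next_in_in[of J n j] J(4)
      by (metis Suc_eq_plus1 card.remove)
    moreover have "card (insert j L) = card L + 1" using j L finite_subset by fastforce
    ultimately show ?thesis using J J' by auto
  qed
  then show ?thesis unfolding blade_space_def by (auto simp: in_keys_iff)
qed

text \<open>
  The sets \<open>J\<close> with \<open>\<partial>\<^sub>j\<close> sending \<open>\<beta>\<^sub>J\<close> to \<open>\<beta>\<^sub>I\<close> are those obtained from \<open>I\<close> by adding an element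
  that comes, as seen from \<open>j\<close>, before all of \<open>I\<close>.
\<close>

lemma lookup_boundary_arc:
  assumes n: "n \<ge> 2" and j: "j \<in> {1..n} - L" and \<beta>: "\<beta> \<in> blade_space k n L"
    and nf: "nonfrozen n (insert j L) I"
  shows "Poly_Mapping.lookup (boundary n j \<beta>) (insert j L, I) =
    (\<Sum>l\<in>arc n ({1..n} - L) j (next_in n j I). Poly_Mapping.lookup \<beta> (L, insert l I))"
proof -
  let ?S = "{1..n} - L" and ?K = "Poly_Mapping.keys \<beta>" and ?E = "arc n ({1..n} - L) j (next_in n j I)"
  let ?F = "{z \<in> ?K. snd z - {next_in n j (snd z)} = I}"
  have finI: "finite I" and Ine: "I \<noteq> {}"
    using nonfrozen_finite[OF nf] nonfrozen_nonempty[OF _ nf] n by auto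
  have jn: "j \<in> {1..n}" using j by auto
  have lI: "l \<notin> I" if "l \<in> ?E" for l
    using next_in_least[OF finI Ine, of l n j] that by (force simp: arc_def)
  have nl: "next_in n j (insert l I) = l" if "l \<in> ?E" for l
  proof -
    have m: "next_in n j (insert l I) \<in> insert l I"
      "cdist n j (next_in n j (insert l I)) \<le> cdist n j l"
      using next_in_in[of "insert l I" n j] next_in_least[of "insert l I" l n j] finI by auto
    have "cdist n j l < cdist n j (next_in n j I)" using that by (simp add: arc_def)
    then show ?thesis using m next_in_least[OF finI Ine, of "next_in n j (insert l I)" n j] by auto
  qed
  have inj: "inj_on (\<lambda>l. (L, insert l I)) ?E"
    using lI by (intro inj_onI) (metis insertE insertI1 prod.inject)
  have finE: "finite ?E" unfolding arc_def by auto
  have "Poly_Mapping.lookup (boundary n j \<beta>) (insert j L, I) =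
    (\<Sum>z\<in>?K. if snd z - {next_in n j (snd z)} = I then Poly_Mapping.lookup \<beta> z else 0)"
    unfolding lookup_boundary[OF n j \<beta>]
  proof (rule sum.cong[OF refl])
    fix z assume "z \<in> ?K"
    then obtain J where z: "z = (L, J)" using \<beta> by (auto simp: blade_space_def)
    show "(case z of (K, J) \<Rightarrow> if nonfrozen n (insert j L) (J - {next_in n j J})
        \<and> insert j L = insert j L \<and> J - {next_in n j J} = I then Poly_Mapping.lookup \<beta> (L, J) else 0)
      = (if snd z - {next_in n j (snd z)} = I then Poly_Mapping.lookup \<beta> z else 0)"
      using nf unfolding z by (cases "J - {next_in n j J} = I") simp_all
  qed
  also have "\<dots> = (\<Sum>z\<in>?F. Poly_Mapping.lookup \<beta> z)" by (simp add: sum.inter_filter)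
  also have "\<dots> = (\<Sum>z\<in>(\<lambda>l. (L, insert l I)) ` ?E. Poly_Mapping.lookup \<beta> z)"
  proof (rule sum.mono_neutral_left)
    show "finite ((\<lambda>l. (L, insert l I)) ` ?E)" using finE by simp
    show "?F \<subseteq> (\<lambda>l. (L, insert l I)) ` ?E"
    proof
      fix z assume z: "z \<in> ?F"
      then obtain J where J: "z = (L, J)" "nonfrozen n L J" "J - {next_in n j J} = I"
        using \<beta> by (auto simp: blade_space_def)
      let ?l = "next_in n j J"
      have JS: "J \<subseteq> ?S" using J by (simp add: nonfrozen_def)
      have fJ: "finite J" "J \<noteq> {}" using nonfrozen_finite[OF J(2)] nonfrozen_nonempty[OF _ J(2)] n by auto
      have l: "?l \<in> J" using next_in_in[OF fJ] .
      have p: "next_in n j I \<in> I" using next_in_in[OF finI Ine] .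
      have "cdist n j ?l \<le> cdist n j (next_in n j I)" "?l \<noteq> next_in n j I"
        using next_in_least[OF fJ, of "next_in n j I" n j] p J(3) by auto
      moreover have "?l \<in> {1..n}" "next_in n j I \<in> {1..n}" using l p J(3) JS by auto
      ultimately have "cdist n j ?l < cdist n j (next_in n j I)"
        using cdist_inj[OF jn] by (simp add: le_neq_implies_less)
      then have "?l \<in> ?E" using l JS by (auto simp: arc_def)
      moreover have "J = insert ?l I" using J(3) l by auto
      ultimately show "z \<in> (\<lambda>l. (L, insert l I)) ` ?E" using J(1) by blast
    qed
    show "\<forall>z\<in>(\<lambda>l. (L, insert l I)) ` ?E - ?F. Poly_Mapping.lookup \<beta> z = 0"
      using nl lI by (auto simp: in_keys_iff)
  qed
  also have "\<dots> = (\<Sum>l\<in>?E. Poly_Mapping.lookup \<beta> (L, insert l I))"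
    by (subst sum.reindex[OF inj]) simp
  finally show ?thesis .
qed

text \<open>
  The bound on the length of the list keeps at least two elements in \<open>I\<close> after each boundary, as the
  telescoping requires.
\<close>

lemma boundary_list_Phi:
  assumes n: "n \<ge> 2" and "distinct xs" "set xs \<subseteq> {1..n}" "length xs + 2 \<le> k"
  shows "foldr (boundary n) xs (Phi k n \<pi>) \<in> blade_space k n (set xs)" (is ?A)
    and "nonfrozen n (set xs) I \<Longrightarrow> card I + length xs = k \<Longrightarrow>
      Poly_Mapping.lookup (foldr (boundary n) xs (Phi k n \<pi>)) (set xs, I) =
      blade_coeff n ({1..n} - set xs) (\<lambda>K. Poly_Mapping.lookup \<pi> (set xs \<union> K)) I" (is "_ \<Longrightarrow> _ \<Longrightarrow> ?B")
  using assms(2-)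
proof (induction xs arbitrary: I)
  case Nil
  {
    case 1 then show ?case using Phi_in_blade_space[OF n] by simp
  next
    case 2
    then have "I \<in> nsets {1..n} k" using nonfrozen_finite[of n "{}" I]
      by (simp add: nsets_def nonfrozen_def)
    then show ?case using lookup_Phi[OF n, of I k \<pi>] 2 by simp
  }
next
  case (Cons j xs)
  let ?\<beta> = "foldr (boundary n) xs (Phi k n \<pi>)" and ?L = "set xs" and ?S = "{1..n} - set xs"
  {
    case 1
    then show ?case using Cons.IH(1) boundary_in_blade_space[OF n, of "set xs" j ?\<beta> k] by simp
  next
    case 2
    have \<beta>: "?\<beta> \<in> blade_space k n ?L" using Cons.IH(1) 2 by simp
    have j: "j \<in> {1..n} - set xs" and L: "set xs \<subseteq> {1..n}" using 2 by auto
    have nf: "nonfrozen n (insert j ?L) I" using 2 by simp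
    have finI: "finite I" using nonfrozen_finite[OF nf] .
    have "Poly_Mapping.lookup (foldr (boundary n) (j # xs) (Phi k n \<pi>)) (set (j # xs), I) =
      (\<Sum>l\<in>arc n ?S j (next_in n j I). Poly_Mapping.lookup ?\<beta> (?L, insert l I))"
      using lookup_boundary_arc[OF n j \<beta> nf] by simp
    also have "\<dots> = (\<Sum>l\<in>arc n ?S j (next_in n j I).
        blade_coeff n ?S (\<lambda>K. Poly_Mapping.lookup \<pi> (?L \<union> K)) (insert l I))"
    proof (rule sum.cong[OF refl])
      fix l assume l: "l \<in> arc n ?S j (next_in n j I)"
      have "l \<notin> I" using next_in_least[OF finI, of l n j] l by (force simp: arc_def)
      then have "card (insert l I) + length xs = k" using 2 finI by simp
      then show "Poly_Mapping.lookup ?\<beta> (?L, insert l I) =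
          blade_coeff n ?S (\<lambda>K. Poly_Mapping.lookup \<pi> (?L \<union> K)) (insert l I)"
        using Cons.IH(2)[OF nonfrozen_insert[OF n j nf l]] 2 by simp
    qed
    also have "\<dots> = blade_coeff n (?S - {j}) (\<lambda>K. Poly_Mapping.lookup \<pi> (?L \<union> insert j K)) I"
    proof -
      have "I \<subseteq> ?S - {j}" "2 \<le> card I" using nf 2 by (auto simp: nonfrozen_def)
      from sum_blade_coeff_insert[OF Diff_subset j this refl,
          of "\<lambda>K. Poly_Mapping.lookup \<pi> (?L \<union> K)"] show ?thesis .
    qed
    also have "?S - {j} = {1..n} - set (j # xs)" by auto
    finally show ?case by simp
  }
qed

lemma lookup_boundary_set_Phi:
  assumes "n \<ge> 2" "L \<subseteq> {1..n}" "card L + 2 \<le> k" "nonfrozen n L I" "card I + card L = k"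
  shows "Poly_Mapping.lookup (boundary_set n L (Phi k n \<pi>)) (L, I) =
      blade_coeff n ({1..n} - L) (\<lambda>K. Poly_Mapping.lookup \<pi> (L \<union> K)) I"
proof -
  have fin: "finite L" using assms(2) finite_subset by auto
  then have "set (sorted_list_of_set L) = L" "length (sorted_list_of_set L) = card L" by auto
  then show ?thesis
    using boundary_list_Phi(2)[of n "sorted_list_of_set L" k I \<pi>] assms
    unfolding boundary_set_def by simp
qed

section \<open>Pairs and three-term relations\<close>

definition second_difference :: "nat \<Rightarrow> nat set \<Rightarrow> (nat set \<Rightarrow> real) \<Rightarrow> nat \<Rightarrow> nat \<Rightarrow> real" where
  "second_difference n S f i j =
     f {csucc n S i, j} + f {i, csucc n S j} - f {i, j} - f {csucc n S i, csucc n S j}"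

text \<open>
  A set that is no interval has two terminal points, so here both elements are terminal and neither
  follows the other.
\<close>

lemma nonadjacent_if_not_interval:
  assumes S: "S \<subseteq> {1..n}" and ij: "i \<in> S" "j \<in> S" and nf: "\<not> cyclic_interval n S {i, j}"
  shows "csucc n S i \<noteq> j" "csucc n S j \<noteq> i" and "terminals n S {i, j} = {i, j}"
    and "i \<noteq> j"
proof -
  obtain s t where "s \<in> terminals n S {i, j}" "t \<in> terminals n S {i, j}" "s \<noteq> t"
    using two_terminals_if_not_interval[OF S _ _ nf] ij by auto
  then have *: "terminals n S {i, j} = {i, j} \<and> i \<noteq> j" using terminals_subset[of n S "{i, j}"] by auto
  then show "terminals n S {i, j} = {i, j}" "i \<noteq> j" by auto
  then have "i \<in> terminals n S {i, j}" "j \<in> terminals n S {i, j}" by blast+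
  then show "csucc n S i \<noteq> j" "csucc n S j \<noteq> i" by (auto simp: terminals_def)
qed

text \<open>
  An interval containing two elements contains the successor of the one that comes first.
\<close>

lemma not_interval_if_nonadjacent:
  assumes S: "S \<subseteq> {1..n}" and ij: "i \<in> S" "j \<in> S" "i \<noteq> j"
    and na: "csucc n S i \<noteq> j" "csucc n S j \<noteq> i"
  shows "\<not> cyclic_interval n S {i, j}"
proof
  assume "cyclic_interval n S {i, j}"
  then obtain a m where a: "a \<in> {1..n}" and eq: "{i, j} = {x \<in> S. cdist n a x < m}"
    unfolding cyclic_interval_def by blast
  have mem: "x \<in> {i, j} \<longleftrightarrow> x \<in> S \<and> cdist n a x < m" for x unfolding eq by simp
  have *: "csucc n S u = v"
    if uv: "{u, v} = {i, j}" "u \<noteq> v" "cdist n a u < cdist n a v" for u v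
  proof -
    have uvS: "u \<in> S" "v \<in> S" "cdist n a v < m" using mem[of u] mem[of v] uv by auto
    then have uvn: "u \<in> {1..n}" "v \<in> {1..n}" using S by auto
    note c = csucc_props[OF S uvS(2) uv(2)[symmetric]]
    have cn: "csucc n S u \<in> {1..n}" using c S by auto
    have "cdist n a (csucc n S u) < m"
      using cdist_change_origin[OF a uvn] cdist_change_origin[OF a uvn(1) cn] c(3) uv(3) uvS(3)
      by (auto split: if_splits)
    then have "csucc n S u \<in> {i, j}" using mem[of "csucc n S u"] c by auto
    then show ?thesis using uv c by auto
  qed
  have "i \<in> {1..n}" "j \<in> {1..n}" using ij S by auto
  then have "cdist n a i < cdist n a j \<or> cdist n a j < cdist n a i" using ij cdist_inj[OF a] by force
  then show False using *[OF refl ij(3)] *[OF insert_commute ij(3)[symmetric]] na by blast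
qed

lemma blade_coeff_pair:
  assumes S: "S \<subseteq> {1..n}" and ij: "i \<in> S" "j \<in> S" and nf: "\<not> cyclic_interval n S {i, j}"
  shows "blade_coeff n S f {i, j} = second_difference n S f i j"
proof -
  note na = nonadjacent_if_not_interval[OF S ij nf]
  let ?h = "\<lambda>N. f (shift n S {i, j} N)"
  have "blade_coeff n S f {i, j} = - alt_sum {i, j} ?h" unfolding blade_coeff_def na(3) ..
  also have "\<dots> = - (?h {} - ?h {j} - (?h {i} - ?h {i, j}))"
    using na(4) by (subst alt_sum_insert, simp, simp, subst (1 2) alt_sum_insert) auto
  also have "\<dots> = second_difference n S f i j"
    using na(4) by (simp add: shift_def second_difference_def insert_Diff_if insert_commute)
  finally show ?thesis .
qed

text \<open>
  Two nested telescoping sums, as for a double integral of a mixed derivative.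
\<close>

lemma sum_second_difference:
  assumes S: "S \<subseteq> {1..n}" and m: "a \<in> S" "b \<in> S" "c \<in> S" "d \<in> S"
  shows "(\<Sum>i\<in>arc n S a b. \<Sum>j\<in>arc n S c d. second_difference n S f i j)
    = f {a, d} + f {b, c} - f {a, c} - f {b, d}"
proof -
  let ?s = "csucc n S"
  have "(\<Sum>j\<in>arc n S c d. second_difference n S f i j)
      = (f {i, d} - f {i, c}) - (f {?s i, d} - f {?s i, c})" for i
  proof -
    have "(\<Sum>j\<in>arc n S c d. second_difference n S f i j)
      = (\<Sum>j\<in>arc n S c d. (f {?s i, j} - f {i, j}) - (f {?s i, ?s j} - f {i, ?s j}))"
      by (simp add: second_difference_def algebra_simps)
    also have "\<dots> = (f {?s i, c} - f {i, c}) - (f {?s i, d} - f {i, d})"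
      by (rule sum_arc_telescope[OF S m(3,4)])
    finally show ?thesis by simp
  qed
  then have "(\<Sum>i\<in>arc n S a b. \<Sum>j\<in>arc n S c d. second_difference n S f i j)
     = (\<Sum>i\<in>arc n S a b. (f {i, d} - f {i, c}) - (f {?s i, d} - f {?s i, c}))" by simp
  also have "\<dots> = (f {a, d} - f {a, c}) - (f {b, d} - f {b, c})"
    by (rule sum_arc_telescope[OF S m(1,2)])
  finally show ?thesis by simp
qed

text \<open>
  The successor of \<open>i \<in> [a, b)\<close> is at most \<open>b\<close>, hence before \<open>c\<close>; the successor of \<open>j \<in> [c, d)\<close> is at
  most \<open>d\<close>, hence does not wrap around to \<open>i\<close>.
\<close>

lemma rectangle_nonadjacent:
  assumes S: "S \<subseteq> {1..n}" and m: "{a, b, c, d} \<subseteq> S" and cyc: "cyc4 n a b c d"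
    and i: "i \<in> arc n S a b" and j: "j \<in> arc n S c d"
  shows "i \<in> S" "j \<in> S" "\<not> cyclic_interval n S {i, j}"
proof -
  have mS: "a \<in> S" "b \<in> S" "c \<in> S" "d \<in> S" using m by auto
  have an: "a \<in> {1..n}" using mS S by auto
  have lt: "0 < cdist n a b" "cdist n a b < cdist n a c" "cdist n a c < cdist n a d"
    using cyc by (auto simp: cyc4_def)
  have i': "i \<in> S" "cdist n a i < cdist n a b"
    using i by (auto simp: arc_def)
  have j': "j \<in> S" "cdist n a c \<le> cdist n a j" "cdist n a j < cdist n a d"
    using j arc_iff[OF S an mS(3,4)] lt by auto
  show "i \<in> S" "j \<in> S" using i' j' by auto
  have "b \<noteq> i" "d \<noteq> j" using i' j' by auto
  have "cdist n a (csucc n S i) \<le> cdist n a b"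
    using csucc_cases[OF S mS(1) i'(1) mS(2) \<open>b \<noteq> i\<close>] i'(2) mS(2) by auto
  moreover have "cdist n a j < cdist n a (csucc n S j)"
    using csucc_cases[OF S mS(1) j'(1) mS(4) \<open>d \<noteq> j\<close>] j'(3) mS(4) by auto
  ultimately have "csucc n S i \<noteq> j" "csucc n S j \<noteq> i" "i \<noteq> j" using i' j' lt by auto
  then show "\<not> cyclic_interval n S {i, j}"
    using not_interval_if_nonadjacent[OF S i'(1) j'(1)] by blast
qed

lemma four_point_sum:
  assumes S: "S \<subseteq> {1..n}" and m: "{a, b, c, d} \<subseteq> S" and cyc: "cyc4 n a b c d"
  shows "(\<Sum>i\<in>arc n S a b. \<Sum>j\<in>arc n S c d. blade_coeff n S f {i, j})
    = f {a, d} + f {b, c} - f {a, c} - f {b, d}"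
proof -
  have "(\<Sum>i\<in>arc n S a b. \<Sum>j\<in>arc n S c d. blade_coeff n S f {i, j})
      = (\<Sum>i\<in>arc n S a b. \<Sum>j\<in>arc n S c d. second_difference n S f i j)"
    using blade_coeff_pair[OF S] rectangle_nonadjacent[OF S m cyc] by (auto intro!: sum.cong)
  then show ?thesis using sum_second_difference[OF S] m by simp
qed

text \<open>
  The two conditions that define \<open>\<Z>\<^sub>k\<^sub>,\<^sub>n\<close>, for a single \<open>L\<close>.
\<close>

definition nonneg_noncrossing :: "nat \<Rightarrow> nat set \<Rightarrow> (nat set \<Rightarrow> real) \<Rightarrow> bool" where
  "nonneg_noncrossing n L \<omega> \<longleftrightarrow> (\<forall>J \<in> nonfrozen_pairs n L. 0 \<le> \<omega> J) \<and>
     matroidal_pairs n {J \<in> nonfrozen_pairs n L. \<omega> J \<noteq> 0}"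

lemma nonfrozen_pairs_iff:
  "{i, j} \<in> nonfrozen_pairs n L \<longleftrightarrow>
     i \<in> {1..n} - L \<and> j \<in> {1..n} - L \<and> i \<noteq> j \<and> \<not> cyclic_interval n ({1..n} - L) {i, j}"
  unfolding nonfrozen_pairs_def nonfrozen_def by auto

text \<open>
  With \<open>X\<close> and \<open>Y\<close> the rectangle sums for \<open>[a, b) \<times> [c, d)\<close> and \<open>[b, c) \<times> [d, a)\<close>, the relation for
  \<open>a, b, c, d\<close> reads \<open>min X Y = 0\<close>. Nonnegative coefficients give \<open>X, Y \<ge> 0\<close>, and a pair from the first rectangle
  crosses every pair from the second, so noncrossing support makes one sum vanish. Conversely, the
  smallest rectangles give nonnegativity, and for crossing pairs \<open>{i, j}\<close> and \<open>{a, b}\<close> in the support the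
  relation at \<open>i, a, j, b\<close> would have \<open>X > 0\<close> and \<open>Y > 0\<close>.
\<close>

lemma three_term_iff_nonneg_noncrossing:
  assumes S: "S = {1..n} - L"
  shows "(\<forall>a b c d. cyc4 n a b c d \<longrightarrow> {a, b, c, d} \<subseteq> S \<longrightarrow>
            f {a, c} + f {b, d} = min (f {a, d} + f {b, c}) (f {a, b} + f {c, d}))
     \<longleftrightarrow> nonneg_noncrossing n L (blade_coeff n S f)" (is "?T \<longleftrightarrow> ?W")
proof
  have Sn: "S \<subseteq> {1..n}" using S by auto
  assume T: ?T
  have nn: "0 \<le> blade_coeff n S f {i, j}"
    if ij: "i \<in> S" "j \<in> S" "\<not> cyclic_interval n S {i, j}" for i j
  proof -
    note na = nonadjacent_if_not_interval[OF Sn ij]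
    let ?s = "csucc n S"
    note ci = csucc_props[OF Sn ij(2) na(4)[symmetric]]
    note cj = csucc_props[OF Sn ij(1) na(4)]
    have n: "i \<in> {1..n}" "j \<in> {1..n}" "?s i \<in> {1..n}" "?s j \<in> {1..n}" using ij ci cj Sn by auto
    have "0 < cdist n i (?s i)" using cdist_eq_0_iff[OF n(1,3)] ci by auto
    moreover have "cdist n i (?s i) < cdist n i j"
      using ci(3) na(1) cdist_inj[OF n(1,3,2)] by (auto simp: le_less)
    moreover have "cdist n i j < cdist n i (?s j)"
      using csucc_cases[OF Sn ij(1,2,1) na(4)] na(2) by auto
    ultimately have "cyc4 n i (?s i) j (?s j)" using n by (auto simp: cyc4_def)
    then have "f {i, j} + f {?s i, ?s j} \<le> f {i, ?s j} + f {?s i, j}"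
      using T[rule_format, of i "?s i" j "?s j"] ij ci cj by auto
    then show ?thesis using blade_coeff_pair[OF Sn ij] by (simp add: second_difference_def)
  qed
  have pos: "0 < f {i, b} + f {a, j} - f {i, j} - f {a, b}"
    if cyc: "cyc4 n i a j b" and m: "{i, a, j, b} \<subseteq> S" and ne: "blade_coeff n S f {i, j} \<noteq> 0" for i a j b
  proof -
    have fin: "finite (arc n S u v)" for u v unfolding arc_def S by auto
    have i: "i \<in> arc n S i a" and j: "j \<in> arc n S j b"
      using m cyc cdist_eq_0_iff[of j n b] by (auto simp: arc_def cyc4_def)
    note r = rectangle_nonadjacent[OF Sn m cyc]
    have c: "0 \<le> blade_coeff n S f {u, v}" if "u \<in> arc n S i a" "v \<in> arc n S j b" for u v
      using nn r[OF that] by blast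
    have "0 < blade_coeff n S f {i, j}" using c[OF i j] ne by simp
    then have "0 < (\<Sum>v\<in>arc n S j b. blade_coeff n S f {i, v})"
      using c[OF i] fin j by (intro sum_pos2[of _ j]) auto
    then have "0 < (\<Sum>u\<in>arc n S i a. \<Sum>v\<in>arc n S j b. blade_coeff n S f {u, v})"
      using c by (intro sum_pos2[OF fin i]) (auto intro!: sum_nonneg)
    then show ?thesis using four_point_sum[OF Sn m cyc, of f] by simp
  qed
  have "\<not> crossing n I J"
    if I: "I \<in> nonfrozen_pairs n L" "blade_coeff n S f I \<noteq> 0"
      and J: "J \<in> nonfrozen_pairs n L" "blade_coeff n S f J \<noteq> 0" for I J
  proof
    assume "crossing n I J"
    then obtain i a j b where x: "I = {i, j}" "J = {a, b}" and cyc: "cyc4 n i a j b"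
      unfolding crossing_def by blast
    have m: "{i, a, j, b} \<subseteq> S" "{a, j, b, i} \<subseteq> S" using I(1) J(1) unfolding x nonfrozen_pairs_iff S by auto
    have "0 < f {i, b} + f {a, j} - f {i, j} - f {a, b}" using pos[OF cyc m(1)] I(2) x by simp
    moreover have "0 < f {a, i} + f {j, b} - f {a, b} - f {j, i}"
      using pos[OF cyc4_rotate[OF cyc] m(2)] J(2) x by simp
    moreover have "f {i, j} + f {a, b} = min (f {i, b} + f {a, j}) (f {i, a} + f {j, b})"
      using T cyc m(1) by blast
    ultimately show False by (auto simp: insert_commute min_def split: if_splits)
  qed
  moreover have "0 \<le> blade_coeff n S f J" if J: "J \<in> nonfrozen_pairs n L" for J
  proof -
    obtain i j where "J = {i, j}" using J by (auto simp: nonfrozen_pairs_def nsets_def card_2_iff)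
    then show ?thesis using nn J nonfrozen_pairs_iff S by auto
  qed
  ultimately show ?W unfolding nonneg_noncrossing_def matroidal_pairs_def pairwise_def by blast
next
  have Sn: "S \<subseteq> {1..n}" using S by auto
  assume W: ?W
  show ?T
  proof (intro allI impI)
    fix a b c d assume cyc: "cyc4 n a b c d" and m: "{a, b, c, d} \<subseteq> S"
    have m': "{b, c, d, a} \<subseteq> S" using m by auto
    note cyc' = cyc4_rotate[OF cyc]
    note r = rectangle_nonadjacent[OF Sn m cyc] and r' = rectangle_nonadjacent[OF Sn m' cyc']
    have nn: "0 \<le> blade_coeff n S f {u, v}" if "u \<in> S" "v \<in> S" "\<not> cyclic_interval n S {u, v}" for u v
      using W nonadjacent_if_not_interval(4)[OF Sn that] that
      unfolding nonneg_noncrossing_def S using nonfrozen_pairs_iff by blast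
    define X where "X = f {a, d} + f {b, c} - f {a, c} - f {b, d}"
    define Y where "Y = f {a, b} + f {c, d} - f {a, c} - f {b, d}"
    have X: "X = (\<Sum>i\<in>arc n S a b. \<Sum>j\<in>arc n S c d. blade_coeff n S f {i, j})"
      using four_point_sum[OF Sn m cyc] by (simp add: X_def)
    have Y: "Y = (\<Sum>i\<in>arc n S b c. \<Sum>j\<in>arc n S d a. blade_coeff n S f {i, j})"
      using four_point_sum[OF Sn m' cyc'] by (simp add: Y_def insert_commute)
    have "0 \<le> X" "0 \<le> Y" unfolding X Y using nn r r' by (auto intro!: sum_nonneg)
    moreover have "X = 0 \<or> Y = 0"
    proof (rule ccontr)
      assume "\<not> ?thesis"
      then have nz: "X \<noteq> 0" "Y \<noteq> 0" by auto
      obtain i where i: "i \<in> arc n S a b" "(\<Sum>j\<in>arc n S c d. blade_coeff n S f {i, j}) \<noteq> 0"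
        using nz(1) unfolding X by (meson sum.neutral)
      obtain j where j: "j \<in> arc n S c d" "blade_coeff n S f {i, j} \<noteq> 0"
        using i(2) by (meson sum.neutral)
      obtain i' where i': "i' \<in> arc n S b c" "(\<Sum>j\<in>arc n S d a. blade_coeff n S f {i', j}) \<noteq> 0"
        using nz(2) unfolding Y by (meson sum.neutral)
      obtain j' where j': "j' \<in> arc n S d a" "blade_coeff n S f {i', j'} \<noteq> 0"
        using i'(2) by (meson sum.neutral)
      note ij = r[OF i(1) j(1)] and ij' = r'[OF i'(1) j'(1)]
      have I: "{i, j} \<in> nonfrozen_pairs n L" "{i', j'} \<in> nonfrozen_pairs n L"
        using ij ij' nonadjacent_if_not_interval(4)[OF Sn ij] nonadjacent_if_not_interval(4)[OF Sn ij']
        unfolding nonfrozen_pairs_iff S by auto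
      have mS: "a \<in> S" "b \<in> S" "c \<in> S" "d \<in> S" using m by auto
      have an: "a \<in> {1..n}" using mS Sn by auto
      have lt: "0 < cdist n a b" "cdist n a b < cdist n a c" "cdist n a c < cdist n a d"
        using cyc by (auto simp: cyc4_def)
      have 1: "cdist n a i < cdist n a b" using i(1) by (simp add: arc_def)
      have 2: "cdist n a b \<le> cdist n a i'" "cdist n a i' < cdist n a c"
        using i'(1) arc_iff[OF Sn an mS(2,3)] lt by auto
      have 3: "cdist n a c \<le> cdist n a j" "cdist n a j < cdist n a d"
        using j(1) arc_iff[OF Sn an mS(3,4)] lt by auto
      have 4: "cdist n a d \<le> cdist n a j'"
        using j'(1) arc_to_origin_iff[OF Sn mS(1,4)] lt by force
      have rn: "i \<in> {1..n}" "j \<in> {1..n}" "i' \<in> {1..n}" "j' \<in> {1..n}" using ij ij' Sn by auto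
      have cr: "cyc4 n i i' j j'"
        using 1 2 3 4 rn cdist_change_origin[OF an rn(1) rn(2)] cdist_change_origin[OF an rn(1) rn(3)]
          cdist_change_origin[OF an rn(1) rn(4)] by (auto simp: cyc4_def)
      have "crossing n {i, j} {i', j'}" unfolding crossing_def using cr by blast
      moreover have "{i, j} \<noteq> {i', j'}" using 1 2 3 4 by (auto simp: doubleton_eq_iff)
      moreover have "pairwise (\<lambda>I J. \<not> crossing n I J) {J \<in> nonfrozen_pairs n L. blade_coeff n S f J \<noteq> 0}"
        using W by (simp add: nonneg_noncrossing_def matroidal_pairs_def)
      ultimately show False using I j(2) j'(2) pairwiseD[of "\<lambda>I J. \<not> crossing n I J"] by simp
    qed
    ultimately show "f {a, c} + f {b, d} = min (f {a, d} + f {b, c}) (f {a, b} + f {c, d})"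
      unfolding X_def Y_def by (auto simp: min_def)
  qed
qed

lemma trop_plus_G_iff:
  "\<pi> \<in> trop_plus_G k n \<longleftrightarrow> \<pi> \<in> plucker_space k n \<and>
     (\<forall>L\<in>nsets {1..n} (k - 2). nonneg_noncrossing n L
        (blade_coeff n ({1..n} - L) (\<lambda>K. Poly_Mapping.lookup \<pi> (L \<union> K))))"
proof -
  have *: "L \<in> nsets ({1..n} - {a, b, c, d}) (k - 2) \<longleftrightarrow>
      L \<in> nsets {1..n} (k - 2) \<and> {a, b, c, d} \<subseteq> {1..n} - L" if "cyc4 n a b c d" for L a b c d
    using that unfolding cyc4_def nsets_def by auto
  show ?thesis
    unfolding three_term_iff_nonneg_noncrossing[OF refl, symmetric] trop_plus_G_def mem_Collect_eq
  proof (rule conj_cong[OF refl], intro iffI ballI allI impI)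
    fix L a b c d
    assume H: "\<forall>a b c d. cyc4 n a b c d \<longrightarrow> (\<forall>L\<in>nsets ({1..n} - {a, b, c, d}) (k - 2).
          Poly_Mapping.lookup \<pi> (L \<union> {a, c}) + Poly_Mapping.lookup \<pi> (L \<union> {b, d}) =
          min (Poly_Mapping.lookup \<pi> (L \<union> {a, d}) + Poly_Mapping.lookup \<pi> (L \<union> {b, c}))
              (Poly_Mapping.lookup \<pi> (L \<union> {a, b}) + Poly_Mapping.lookup \<pi> (L \<union> {c, d})))"
      and L: "L \<in> nsets {1..n} (k - 2)" and c: "cyc4 n a b c d" and m: "{a, b, c, d} \<subseteq> {1..n} - L"
    show "Poly_Mapping.lookup \<pi> (L \<union> {a, c}) + Poly_Mapping.lookup \<pi> (L \<union> {b, d}) =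
          min (Poly_Mapping.lookup \<pi> (L \<union> {a, d}) + Poly_Mapping.lookup \<pi> (L \<union> {b, c}))
              (Poly_Mapping.lookup \<pi> (L \<union> {a, b}) + Poly_Mapping.lookup \<pi> (L \<union> {c, d}))"
      using H[rule_format, OF c] *[OF c] L m by blast
  next
    fix a b c d L
    assume H: "\<forall>L\<in>nsets {1..n} (k - 2). \<forall>a b c d. cyc4 n a b c d \<longrightarrow> {a, b, c, d} \<subseteq> {1..n} - L \<longrightarrow>
          Poly_Mapping.lookup \<pi> (L \<union> {a, c}) + Poly_Mapping.lookup \<pi> (L \<union> {b, d}) =
          min (Poly_Mapping.lookup \<pi> (L \<union> {a, d}) + Poly_Mapping.lookup \<pi> (L \<union> {b, c}))
              (Poly_Mapping.lookup \<pi> (L \<union> {a, b}) + Poly_Mapping.lookup \<pi> (L \<union> {c, d}))"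
      and c: "cyc4 n a b c d" and L: "L \<in> nsets ({1..n} - {a, b, c, d}) (k - 2)"
    have L': "L \<in> nsets {1..n} (k - 2)" "{a, b, c, d} \<subseteq> {1..n} - L" using *[OF c] L by auto
    show "Poly_Mapping.lookup \<pi> (L \<union> {a, c}) + Poly_Mapping.lookup \<pi> (L \<union> {b, d}) =
          min (Poly_Mapping.lookup \<pi> (L \<union> {a, d}) + Poly_Mapping.lookup \<pi> (L \<union> {b, c}))
              (Poly_Mapping.lookup \<pi> (L \<union> {a, b}) + Poly_Mapping.lookup \<pi> (L \<union> {c, d}))"
      using H[rule_format, OF L'(1) c L'(2)] .
  qed
qed

lemma Phi_in_Z_set_iff:
  assumes "2 \<le> k" "2 \<le> n" "\<pi> \<in> plucker_space k n"
  shows "Phi k n \<pi> \<in> Z_set k n \<longleftrightarrow> \<pi> \<in> trop_plus_G k n"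
proof -
  have "nonneg_noncrossing n L (\<lambda>J. Poly_Mapping.lookup (boundary_set n L (Phi k n \<pi>)) (L, J)) \<longleftrightarrow>
    nonneg_noncrossing n L (blade_coeff n ({1..n} - L) (\<lambda>K. Poly_Mapping.lookup \<pi> (L \<union> K)))"
    if L: "L \<in> nsets {1..n} (k - 2)" for L
  proof -
    have e: "Poly_Mapping.lookup (boundary_set n L (Phi k n \<pi>)) (L, J) =
        blade_coeff n ({1..n} - L) (\<lambda>K. Poly_Mapping.lookup \<pi> (L \<union> K)) J"
      if "J \<in> nonfrozen_pairs n L" for J
      using that L assms by (intro lookup_boundary_set_Phi) (auto simp: nonfrozen_pairs_def nsets_def)
    have "{J \<in> nonfrozen_pairs n L. Poly_Mapping.lookup (boundary_set n L (Phi k n \<pi>)) (L, J) \<noteq> 0}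
      = {J \<in> nonfrozen_pairs n L.
           blade_coeff n ({1..n} - L) (\<lambda>K. Poly_Mapping.lookup \<pi> (L \<union> K)) J \<noteq> 0}"
      using e by auto
    then show ?thesis unfolding nonneg_noncrossing_def using e by simp
  qed
  then show ?thesis
    using Phi_in_blade_space[OF assms(2), of k \<pi>] assms(3) unfolding trop_plus_G_iff
    by (simp add: Z_set_def Let_def nonneg_noncrossing_def[symmetric])
qed

section \<open>The lineality space is the kernel\<close>

lemma subspace_keys: "subspace {p :: 'a \<Rightarrow>\<^sub>0 real. Poly_Mapping.keys p \<subseteq> A}"
proof (rule subspaceI)
  fix p q :: "'a \<Rightarrow>\<^sub>0 real"
  assume "p \<in> {p. Poly_Mapping.keys p \<subseteq> A}" "q \<in> {p. Poly_Mapping.keys p \<subseteq> A}"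
  then show "p + q \<in> {p. Poly_Mapping.keys p \<subseteq> A}" using keys_add[of p q] by blast
qed (auto simp: in_keys_iff)

lemma finite_subsets_n: "finite (nsets {1..n::nat} k)"
  by (simp add: finite_imp_finite_nsets)

definition star_vector :: "nat \<Rightarrow> nat \<Rightarrow> nat \<Rightarrow> nat set \<Rightarrow>\<^sub>0 real" where
  "star_vector k n a = (\<Sum>J | J \<in> nsets {1..n} k \<and> a \<in> J. Poly_Mapping.single J 1)"

lemma lineality_space_eq: "lineality_space k n = span (star_vector k n ` {1..n})"
proof -
  have "{\<Sum>J | J \<in> nsets {1..n} k \<and> a \<in> J. Poly_Mapping.single J (1::real) | a. a \<in> {1..n}}
      = star_vector k n ` {1..n}"
    unfolding star_vector_def by blast
  then show ?thesis unfolding lineality_space_def by simp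
qed

lemma lookup_star_vector:
  "Poly_Mapping.lookup (star_vector k n a) J = (if J \<in> nsets {1..n} k \<and> a \<in> J then 1 else 0)"
proof -
  have "Poly_Mapping.lookup (star_vector k n a) J
     = (\<Sum>K | K \<in> nsets {1..n} k \<and> a \<in> K. if K = J then 1 else 0)"
    by (simp add: star_vector_def lookup_sum lookup_single when_def)
  then show ?thesis using finite_subsets_n[of n k] by (simp add: sum.delta')
qed

lemma star_vector_in: "star_vector k n a \<in> plucker_space k n"
  by (auto simp: plucker_space_def in_keys_iff lookup_star_vector split: if_splits)

lemma subspace_plucker_space: "subspace (plucker_space k n)"
  unfolding plucker_space_def by (rule subspace_keys)

text \<open>
  The coefficients \<open>x\<^sub>a\<close> of the spanning vectors are the weights: the vector for \<open>a\<close> is the indicator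
  function of the sets containing \<open>a\<close>.
\<close>

lemma lineality_space_iff:
  "v \<in> lineality_space k n \<longleftrightarrow>
     v \<in> plucker_space k n \<and> (\<exists>x. \<forall>J\<in>nsets {1..n} k. Poly_Mapping.lookup v J = sum x J)"
proof
  let ?W = "{v \<in> plucker_space k n. \<exists>x. \<forall>J\<in>nsets {1..n} k. Poly_Mapping.lookup v J = sum x J}"
  have "subspace ?W"
  proof (rule subspaceI)
    show "0 \<in> ?W" using subspace_0[OF subspace_plucker_space]
      by (auto intro!: exI[of _ "\<lambda>_. 0"])
    fix u v assume "u \<in> ?W" "v \<in> ?W"
    then obtain x y where "u \<in> plucker_space k n" "v \<in> plucker_space k n"
      "\<forall>J\<in>nsets {1..n} k. Poly_Mapping.lookup u J = sum x J"
      "\<forall>J\<in>nsets {1..n} k. Poly_Mapping.lookup v J = sum y J" by blast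
    then show "u + v \<in> ?W"
      using subspace_add[OF subspace_plucker_space]
      by (auto simp: lookup_add sum.distrib intro!: exI[of _ "\<lambda>i. x i + y i"])
  next
    fix c v assume "v \<in> ?W"
    then obtain x where "v \<in> plucker_space k n"
      "\<forall>J\<in>nsets {1..n} k. Poly_Mapping.lookup v J = sum x J" by blast
    then show "c *\<^sub>R v \<in> ?W"
      using subspace_scale[OF subspace_plucker_space]
      by (auto simp: sum_distrib_left intro!: exI[of _ "\<lambda>i. c * x i"])
  qed
  moreover have "star_vector k n a \<in> ?W" for a
  proof -
    have "Poly_Mapping.lookup (star_vector k n a) J = (\<Sum>i\<in>J. if i = a then 1 else 0)"
      if "J \<in> nsets {1..n} k" for J
      using that by (auto simp: lookup_star_vector nsets_def)
    then have "\<exists>x. \<forall>J\<in>nsets {1..n} k. Poly_Mapping.lookup (star_vector k n a) J = sum x J" by blast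
    then show ?thesis using star_vector_in by blast
  qed
  ultimately have sub: "lineality_space k n \<subseteq> ?W"
    unfolding lineality_space_eq by (intro span_minimal) auto
  then show "v \<in> plucker_space k n \<and> (\<exists>x. \<forall>J\<in>nsets {1..n} k. Poly_Mapping.lookup v J = sum x J)"
    if "v \<in> lineality_space k n" using that by blast
  assume "v \<in> plucker_space k n \<and> (\<exists>x. \<forall>J\<in>nsets {1..n} k. Poly_Mapping.lookup v J = sum x J)"
  then obtain x where v: "v \<in> plucker_space k n"
    and x: "\<And>J. J \<in> nsets {1..n} k \<Longrightarrow> Poly_Mapping.lookup v J = sum x J" by blast
  have "v = (\<Sum>a\<in>{1..n}. x a *\<^sub>R star_vector k n a)"
  proof (rule poly_mapping_eqI)
    fix J
    have r: "Poly_Mapping.lookup (\<Sum>a\<in>{1..n}. x a *\<^sub>R star_vector k n a) J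
        = (\<Sum>a\<in>{1..n}. if J \<in> nsets {1..n} k \<and> a \<in> J then x a else 0)"
      unfolding lookup_sum by (rule sum.cong) (simp_all add: lookup_star_vector)
    show "Poly_Mapping.lookup v J = Poly_Mapping.lookup (\<Sum>a\<in>{1..n}. x a *\<^sub>R star_vector k n a) J"
    proof (cases "J \<in> nsets {1..n} k")
      case True
      then have "(\<Sum>a\<in>{1..n}. if a \<in> J then x a else 0) = sum x ({1..n} \<inter> J)"
        by (simp add: sum.inter_restrict)
      moreover have "{1..n} \<inter> J = J" using True by (auto simp: nsets_def)
      ultimately show ?thesis using x[OF True] r True by simp
    next
      case False
      then have "Poly_Mapping.lookup v J = 0" using v by (auto simp: plucker_space_def in_keys_iff)
      then show ?thesis using r False by simp
    qed
  qed
  moreover have "(\<Sum>a\<in>{1..n}. x a *\<^sub>R star_vector k n a) \<in> lineality_space k n"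
    unfolding lineality_space_eq by (intro span_sum span_scale span_base imageI)
  ultimately show "v \<in> lineality_space k n" by metis
qed

text \<open>
  A second difference of an additive function vanishes.
\<close>

lemma alt_sum_additive_eq_0:
  assumes "finite T" "s \<in> T" "t \<in> T" "s \<noteq> t"
  shows "alt_sum T (\<lambda>N. c + sum w N) = 0"
proof -
  define U where "U = T - {s, t}"
  have T: "T = insert s (insert t U)" and fU: "finite U" and sU: "s \<notin> U" "t \<notin> U" 
    using assms by (auto simp: U_def)
  let ?h = "\<lambda>N. c + sum w N"
  have "alt_sum T ?h = alt_sum U ?h - alt_sum U (\<lambda>N. ?h (insert t N))
      - (alt_sum U (\<lambda>N. ?h (insert s N)) - alt_sum U (\<lambda>N. ?h (insert s (insert t N))))"
    unfolding T using fU sU assms(4) by (simp add: alt_sum_insert)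
  also have "\<dots> = alt_sum U (\<lambda>N. ?h N - ?h (insert t N) - (?h (insert s N) - ?h (insert s (insert t N))))"
    by (simp only: alt_sum_diff)
  also have "\<dots> = alt_sum U (\<lambda>N. 0)"
  proof (rule alt_sum_cong)
    fix N assume "N \<subseteq> U"
    then have "finite N" "s \<notin> N" "t \<notin> N" using fU sU finite_subset by auto
    then show "?h N - ?h (insert t N) - (?h (insert s N) - ?h (insert s (insert t N))) = 0"
      using assms(4) by simp
  qed
  finally show ?thesis by (simp add: alt_sum_zero)
qed

text \<open>
  Advancing \<open>N\<close> changes \<open>\<Sum>\<^sub>a\<^sub>\<in>\<^sub>I x\<^sub>a\<close> by a sum over \<open>N\<close>, and a nonfrozen set has two terminal points, so
  every coefficient contains a second difference of an additive function.
\<close>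

lemma Phi_lineality:
  assumes n: "n \<ge> 2" and v: "v \<in> lineality_space k n"
  shows "Phi k n v = 0"
proof (rule poly_mapping_eqI)
  fix z :: "nat set \<times> nat set"
  obtain x where x: "\<And>J. J \<in> nsets {1..n} k \<Longrightarrow> Poly_Mapping.lookup v J = sum x J"
    using v unfolding lineality_space_iff by blast
  show "Poly_Mapping.lookup (Phi k n v) z = Poly_Mapping.lookup 0 z"
  proof (cases "z \<in> Poly_Mapping.keys (Phi k n v)")
    case True
    then obtain I where z: "z = ({}, I)" and nf: "nonfrozen n {} I" and "card I = k"
      using Phi_in_blade_space[OF n, of k v] by (auto simp: blade_space_def)
    then have I: "I \<in> nsets {1..n} k" and IS: "I \<subseteq> {1..n}" "finite I"
      using nonfrozen_finite[OF nf] by (auto simp: nsets_def nonfrozen_def)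
    let ?T = "terminals n {1..n} I" and ?s = "csucc n {1..n}"
    have nci: "\<not> cyclic_interval n {1..n} I" using nf by (simp add: nonfrozen_def)
    have Ine: "I \<noteq> {}" using nonfrozen_nonempty[OF _ nf] n by simp
    obtain s t where st: "s \<in> ?T" "t \<in> ?T" "s \<noteq> t"
      using two_terminals_if_not_interval[OF order_refl IS(1) Ine nci] by blast
    have TI: "?T \<subseteq> I" by (rule terminals_subset)
    have "Poly_Mapping.lookup v (shift n {1..n} I N) = sum x I + (\<Sum>y\<in>N. x (?s y) - x y)"
      if N: "N \<subseteq> ?T" for N
    proof -
      have NI: "N \<subseteq> I" using N TI by blast
      have fN: "finite N" using NI IS finite_subset by blast
      have disj: "(I - N) \<inter> ?s ` N = {}" using N by (auto simp: terminals_def)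
      have inj: "inj_on ?s N" using inj_on_subset[OF inj_csucc_full[OF n]] NI IS by blast
      have "Poly_Mapping.lookup v (shift n {1..n} I N) = sum x ((I - N) \<union> ?s ` N)"
        using x[OF shift_full_in(1)[OF n I N]] by (simp add: shift_def)
      also have "\<dots> = sum x (I - N) + sum x (?s ` N)"
        using IS fN disj by (intro sum.union_disjoint) auto
      also have "sum x (?s ` N) = (\<Sum>y\<in>N. x (?s y))" by (subst sum.reindex[OF inj]) simp
      also have "sum x (I - N) = sum x I - sum x N" using NI IS by (simp add: sum_diff)
      finally show ?thesis by (simp add: sum_subtractf)
    qed
    then have "alt_sum ?T (\<lambda>N. Poly_Mapping.lookup v (shift n {1..n} I N))
      = alt_sum ?T (\<lambda>N. sum x I + (\<Sum>y\<in>N. x (?s y) - x y))" by (rule alt_sum_cong)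
    also have "\<dots> = 0" using st IS TI finite_subset by (intro alt_sum_additive_eq_0) auto
    finally show ?thesis using lookup_Phi[OF n I nf] by (simp add: z blade_coeff_def)
  qed (simp add: in_keys_iff)
qed

text \<open>
  Fix a base set \<open>J0\<close>. The exchange identity lets \<open>f J\<close> be computed from sets closer to \<open>J0\<close> as soon
  as \<open>J - J0\<close> has two elements, so by induction on \<open>|J - J0|\<close> it is enough to find weights that are
  right for \<open>J0\<close> and the sets \<open>J0 - {i} \<union> {j}\<close>. There the exchange identity says that \<open>M i j\<close> is a function of
  \<open>i\<close> plus a function of \<open>j\<close>, and weights can be read off the row and the column of a fixed entry
  \<open>(i0, j0)\<close>.
\<close>

lemma modular_if_exchange:
  fixes f :: "'a set \<Rightarrow> real"
  assumes fin: "finite A" and k: "2 \<le> k" "k < card A"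
    and H: "\<And>L a b c d. distinct [a, b, c, d] \<Longrightarrow> {a, b, c, d} \<subseteq> A \<Longrightarrow>
      L \<in> nsets (A - {a, b, c, d}) (k - 2) \<Longrightarrow>
      f (L \<union> {a, c}) + f (L \<union> {b, d}) = f (L \<union> {a, d}) + f (L \<union> {b, c})"
  obtains x where "\<And>J. J \<in> nsets A k \<Longrightarrow> f J = sum x J"
proof -
  obtain J0 where J0: "J0 \<subseteq> A" "card J0 = k" "finite J0"
    using obtain_subset_with_card_n[of k A] k by (metis fin finite_subset less_imp_le)
  have "J0 \<noteq> {}" using J0 k by auto
  then obtain i0 where i0: "i0 \<in> J0" by auto
  have "J0 \<noteq> A" using J0 k by auto
  then obtain j0 where j0: "j0 \<in> A" "j0 \<notin> J0" using J0 by auto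
  define M where "M i j = f (insert j (J0 - {i}))" for i j
  have M: "M i j + M i0 j0 = M i j0 + M i0 j" if i: "i \<in> J0" and j: "j \<in> A - J0" for i j
  proof (cases "i = i0 \<or> j = j0")
    case False
    let ?L = "J0 - {i, i0}"
    have sub: "{i, i0} \<subseteq> J0" and c2: "card {i, i0} = 2" using False i i0 by auto
    have "card ?L = k - 2"
      using card_Diff_subset[OF _ sub] c2 J0(2) by simp
    then have "?L \<in> nsets (A - {i0, i, j, j0}) (k - 2)"
      using J0 j j0 by (auto simp: nsets_def)
    from H[OF _ _ this] have "f (?L \<union> {i0, j}) + f (?L \<union> {i, j0}) = f (?L \<union> {i0, j0}) + f (?L \<union> {i, j})"
      using False i i0 j j0 J0 by auto
    moreover have "?L \<union> {i0, j} = insert j (J0 - {i})" "?L \<union> {i0, j0} = insert j0 (J0 - {i})"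
      "?L \<union> {i, j0} = insert j0 (J0 - {i0})" "?L \<union> {i, j} = insert j (J0 - {i0})"
      using False i i0 j j0 by auto
    ultimately show ?thesis by (simp add: M_def)
  qed auto
  \<comment> \<open>The shift \<open>s\<close> gives \<open>J0\<close> the right total weight, and \<open>t\<close> does the same for \<open>J0 - {i0} \<union> {j0}\<close>.\<close>
  define s where "s = (f J0 + (\<Sum>i\<in>J0. M i j0)) / real k"
  define t where "t = s - f J0 - M i0 j0"
  define x where "x i = (if i \<in> J0 then s - M i j0 else M i0 i + t)" for i
  have x0: "sum x J0 = f J0"
  proof -
    have "sum x J0 = (\<Sum>i\<in>J0. s - M i j0)" by (simp add: x_def)
    also have "\<dots> = real k * s - (\<Sum>i\<in>J0. M i j0)" using J0 by (simp add: sum_subtractf)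
    also have "\<dots> = f J0" using k by (simp add: s_def)
    finally show ?thesis .
  qed
  have "f J = sum x J" if "J \<in> nsets A k" for J
    using that
  proof (induction "card (J - J0)" arbitrary: J rule: less_induct)
    case less
    have J: "J \<subseteq> A" "finite J" "card J = k" using less.prems by (auto simp: nsets_def)
    have cc: "card (J0 - J) = card (J - J0)"
      using card_Diff_subset_Int[of J0 J] card_Diff_subset_Int[of J J0] J J0
      by (simp add: Int_commute)
    consider "card (J - J0) = 0" | "card (J - J0) = 1" | "2 \<le> card (J - J0)" by linarith
    then show ?case
    proof cases
      case 1
      then have "J \<subseteq> J0" using J by auto
      then have "J = J0" using J J0 by (simp add: card_subset_eq)
      then show ?thesis using x0 by simp
    next
      case 2
      then obtain j where j: "J - J0 = {j}" using card_1_singletonE by blast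
      obtain i where i: "J0 - J = {i}" using cc 2 card_1_singletonE by metis
      have ij: "i \<in> J0" "j \<in> A - J0" using i j J by auto
      have Jeq: "J = insert j (J0 - {i})" using i j by auto
      have "sum x J = x j + (sum x J0 - x i)"
        unfolding Jeq using ij J0 by (simp add: sum_diff1)
      also have "\<dots> = M i j" using M[OF ij] ij x0 by (simp add: x_def t_def)
      finally show ?thesis by (simp add: M_def Jeq)
    next
      case 3
      obtain a c where ac: "a \<in> J - J0" "c \<in> J - J0" "a \<noteq> c"
        using 3 J card_le_Suc0_iff_eq[of "J - J0"] by fastforce
      obtain b d where bd: "b \<in> J0 - J" "d \<in> J0 - J" "b \<noteq> d"
        using 3 cc J0 card_le_Suc0_iff_eq[of "J0 - J"] by fastforce
      let ?L = "J - {a, c}"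
      have finL: "finite ?L" using J by simp
      have "card ?L = k - 2" using card_Diff_subset[of "{a, c}" J] ac J by auto
      then have L: "?L \<in> nsets (A - {a, b, c, d}) (k - 2)"
        using J bd by (auto simp: nsets_def)
      have dist: "distinct [a, b, c, d]" "{a, b, c, d} \<subseteq> A" using ac bd J J0 by auto
      note h = H[OF dist L]
      have Jac: "J = ?L \<union> {a, c}" using ac by auto
      have IH: "f (?L \<union> {u, v}) = sum x ?L + x u + x v"
        if uv: "u \<notin> ?L" "v \<notin> ?L" "u \<noteq> v" "{u, v} \<subseteq> A" "u \<in> J0" "v \<in> J0 \<or> v = a \<or> v = c" for u v
      proof -
        have "card (?L \<union> {u, v}) = k"
          using uv(1-3) \<open>card ?L = k - 2\<close> finL k by (simp add: card_insert_if)
        then have m: "?L \<union> {u, v} \<in> nsets A k" using J uv(4) by (auto simp: nsets_def)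
        have "\<exists>w. w \<in> J - J0 \<and> w \<notin> ?L \<union> {u, v} - J0"
        proof (cases "v = a")
          case True
          then show ?thesis using ac uv(5) by (intro exI[of _ c]) auto
        next
          case False
          then show ?thesis using ac uv(5) by (intro exI[of _ a]) auto
        qed
        moreover have "?L \<union> {u, v} - J0 \<subseteq> J - J0" using uv(5,6) ac by auto
        ultimately have "?L \<union> {u, v} - J0 \<subset> J - J0" by blast
        then have "card (?L \<union> {u, v} - J0) < card (J - J0)" using J by (intro psubset_card_mono) auto
        from less.hyps[OF this m] have "f (?L \<union> {u, v}) = sum x (insert u (insert v ?L))"
          by (simp add: insert_commute)
        then show ?thesis using uv(1-3) finL by simp
      qed
      have "f (?L \<union> {b, d}) = sum x ?L + x b + x d"
        by (rule IH) (use ac bd J J0 in auto)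
      moreover have "f (?L \<union> {d, a}) = sum x ?L + x d + x a"
        by (rule IH) (use ac bd J J0 in auto)
      moreover have "f (?L \<union> {b, c}) = sum x ?L + x b + x c"
        by (rule IH) (use ac bd J J0 in auto)
      ultimately have "f J = sum x ?L + x a + x c"
        using h unfolding Jac[symmetric] by (simp add: insert_commute)
      also have "\<dots> = sum x J"
        using ac J by (simp add: sum_diff)
      finally show ?thesis .
    qed
  qed
  then show thesis using that by blast
qed

lemma boundary_set_zero: "boundary_set n L 0 = 0"
proof -
  have "foldr (boundary n) xs 0 = 0" for xs by (induction xs) (auto simp: boundary_def)
  then show ?thesis by (simp add: boundary_set_def)
qed

text \<open>
  If all pair coefficients vanish, so do all rectangle sums. The rectangles at \<open>a, b, c, d\<close> and at
  \<open>b, c, d, a\<close> make the three sums over the pairings of four points equal, which is the exchange identity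
  in any order of the points.
\<close>

lemma kernel_Phi_subset_lineality:
  assumes k: "2 \<le> k" "k \<le> n - 2" and v: "v \<in> plucker_space k n" and Phi0: "Phi k n v = 0"
  shows "v \<in> lineality_space k n"
proof -
  let ?f = "Poly_Mapping.lookup v"
  have n: "n \<ge> 2" using k by linarith
  have exch: "?f (L \<union> {a, d}) + ?f (L \<union> {b, c}) = ?f (L \<union> {a, c}) + ?f (L \<union> {b, d})"
    if L: "L \<in> nsets ({1..n} - {a, b, c, d}) (k - 2)" and cyc: "cyc4 n a b c d" for L a b c d
  proof -
    let ?S = "{1..n} - L" and ?g = "\<lambda>K. ?f (L \<union> K)"
    have L': "L \<subseteq> {1..n}" "card L + 2 = k" using L k by (auto simp: nsets_def)
    have m: "{a, b, c, d} \<subseteq> ?S" using cyc L by (auto simp: cyc4_def nsets_def)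
    have "blade_coeff n ?S ?g {i, j} = 0"
      if "i \<in> arc n ?S a b" "j \<in> arc n ?S c d" for i j
    proof -
      note r = rectangle_nonadjacent[OF Diff_subset m cyc that]
      have "i \<noteq> j" using nonadjacent_if_not_interval(4)[OF Diff_subset r] .
      then have "nonfrozen n L {i, j}" "card {i, j} + card L = k"
        using r L' by (auto simp: nonfrozen_def)
      from lookup_boundary_set_Phi[OF n L'(1) _ this, of v] show ?thesis
        using L' by (simp add: Phi0 boundary_set_zero)
    qed
    then have "0 = ?g {a, d} + ?g {b, c} - ?g {a, c} - ?g {b, d}"
      using four_point_sum[OF Diff_subset m cyc, of ?g] by simp
    then show ?thesis by simp
  qed
  have all: "?f (L \<union> {a, c}) + ?f (L \<union> {b, d}) = ?f (L \<union> {a, d}) + ?f (L \<union> {b, c})"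
    if L: "L \<in> nsets ({1..n} - {a, b, c, d}) (k - 2)" and dist: "distinct [a, b, c, d]"
      and m: "{a, b, c, d} \<subseteq> {1..n}" for L a b c d
  proof -
    define h where "h u v = ?f (L \<union> {u, v})" for u v
    have hc: "h u v = h v u" for u v by (simp add: h_def insert_commute)
    have E: "h x z + h y w = h x w + h y z \<and> h x z + h y w = h x y + h z w"
      if "cyc4 n x y z w" "{x, y, z, w} = {a, b, c, d}" for x y z w
    proof -
      have "h x w + h y z = h x z + h y w"
        using exch[of L x y z w] L that by (simp add: h_def)
      moreover have "h y x + h z w = h y w + h z x"
        using exch[of L y z w x] cyc4_rotate[OF that(1)] L that
        by (simp add: h_def insert_commute)
      ultimately show ?thesis using hc by simp
    qed
    have i: "a \<in> {1..n}" "b \<in> {1..n}" "c \<in> {1..n}" "d \<in> {1..n}" using m by auto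
    have "cdist n a u \<noteq> cdist n a v" if "u \<in> {a, b, c, d}" "v \<in> {a, b, c, d}" "u \<noteq> v" for u v
      using that i cdist_inj[OF i(1)] by blast
    then have ne: "cdist n a b \<noteq> cdist n a c" "cdist n a b \<noteq> cdist n a d" "cdist n a c \<noteq> cdist n a d"
      "0 < cdist n a b" "0 < cdist n a c" "0 < cdist n a d"
      using dist cdist_eq_0_iff[OF i(1)] i by auto
    then consider "cyc4 n a b c d" | "cyc4 n a b d c" | "cyc4 n a c b d" | "cyc4 n a c d b"
      | "cyc4 n a d b c" | "cyc4 n a d c b"
      using i unfolding cyc4_def by force
    then have "h a c + h b d = h a d + h b c"
    proof cases
      case 1 from E[OF this] show ?thesis using hc by fastforce
    next
      case 2 from E[OF this] show ?thesis using hc[of c d] hc[of b d] hc[of b c] by fastforce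
    next
      case 3 from E[OF this] show ?thesis using hc[of c d] hc[of b d] hc[of b c] by fastforce
    next
      case 4 from E[OF this] show ?thesis using hc[of c d] hc[of b d] hc[of b c] by fastforce
    next
      case 5 from E[OF this] show ?thesis using hc[of c d] hc[of b d] hc[of b c] by fastforce
    next
      case 6 from E[OF this] show ?thesis using hc[of c d] hc[of b d] hc[of b c] by fastforce
    qed
    then show ?thesis by (simp add: h_def)
  qed
  obtain x where "\<And>J. J \<in> nsets {1..n} k \<Longrightarrow> ?f J = sum x J"
  proof (rule modular_if_exchange[of "{1..n}" k ?f])
    show "k < card {1..n}" using k by simp
    show "?f (L \<union> {a, c}) + ?f (L \<union> {b, d}) = ?f (L \<union> {a, d}) + ?f (L \<union> {b, c})"
      if "distinct [a, b, c, d]" "{a, b, c, d} \<subseteq> {1..n}"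
        "L \<in> nsets ({1..n} - {a, b, c, d}) (k - 2)" for L a b c d
      by (rule all[OF that(3,1,2)])
  qed (use k in auto)
  then show ?thesis using v unfolding lineality_space_iff by blast
qed

section \<open>Surjectivity by a dimension count\<close>

text \<open>
  Rank and nullity inside a finite-dimensional subspace of a possibly infinite-dimensional space:
  extend a basis \<open>B\<close> of the span of \<open>K\<close> to a basis of the domain; the added vectors \<open>C\<close> map to
  independent vectors, at least as many as there are in \<open>T\<close>.
\<close>

lemma linear_image_eq_by_dimension:
  fixes F :: "'a::real_vector \<Rightarrow> 'b::real_vector"
  assumes lin: "linear F" and B0: "finite B0" "independent B0" and T: "finite T"
    and im: "F ` span B0 \<subseteq> span T" and K: "finite K" "K \<subseteq> span B0"
    and ker: "\<And>v. v \<in> span B0 \<Longrightarrow> F v = 0 \<Longrightarrow> v \<in> span K"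
    and card: "card T + card K \<le> card B0"
  shows "F ` span B0 = span T"
proof -
  obtain B where B: "B \<subseteq> K" "independent B" "K \<subseteq> span B"
    by (rule real_vector.maximal_independent_subset)
  have BV: "B \<subseteq> span B0" using B(1) K(2) by (rule subset_trans)
  obtain B' where B': "B \<subseteq> B'" "B' \<subseteq> span B0" "independent B'" "span B0 \<subseteq> span B'"
    by (rule real_vector.maximal_independent_subset_extend[OF BV B(2)])
  have finB': "finite B'" using real_vector.independent_span_bound[OF B0(1) B'(3,2)] by simp
  have "B0 \<subseteq> span B'" using B'(4) span_superset[of B0] by blast
  then have cB': "card B0 \<le> card B'" using real_vector.independent_span_bound[OF finB' B0(2)] by simp
  define C where "C = B' - B"
  have CV: "span C \<subseteq> span B0" using span_minimal[of C "span B0"] B' by (auto simp: C_def)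
  have finB: "finite B" and finC: "finite C" using finB' B' finite_subset by (auto simp: C_def)
  have "w = 0" if w: "w \<in> span C" "F w = 0" for w
  proof -
    have "w \<in> span K" using ker w CV by blast
    then have "w \<in> span B" using B(3) span_minimal[of K "span B"] by auto
    then obtain u where u: "w = (\<Sum>v\<in>B. u v *\<^sub>R v)" unfolding span_finite[OF finB] by blast
    obtain t where t: "w = (\<Sum>v\<in>C. t v *\<^sub>R v)" using w(1) unfolding span_finite[OF finC] by blast
    have BC: "B' = B \<union> C" "B \<inter> C = {}" using B' by (auto simp: C_def)
    let ?c = "\<lambda>v. if v \<in> B then u v else - t v"
    have "(\<Sum>v\<in>B'. ?c v *\<^sub>R v) = (\<Sum>v\<in>B. ?c v *\<^sub>R v) + (\<Sum>v\<in>C. ?c v *\<^sub>R v)"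
      unfolding BC(1) using finB finC BC(2) by (rule sum.union_disjoint)
    also have "(\<Sum>v\<in>B. ?c v *\<^sub>R v) = w" unfolding u by (rule sum.cong) auto
    also have "(\<Sum>v\<in>C. ?c v *\<^sub>R v) = (\<Sum>v\<in>C. - (t v *\<^sub>R v))" using BC by (intro sum.cong) auto
    also have "\<dots> = - w" unfolding t by (simp add: sum_negf)
    finally have z: "(\<Sum>v\<in>B'. ?c v *\<^sub>R v) = 0" by simp
    have "t v = 0" if "v \<in> C" for v
    proof -
      have "?c v = 0" using real_vector.independentD[OF B'(3) finB' order_refl z, of v] that BC by blast
      then show ?thesis using that BC by (auto split: if_splits)
    qed
    then show "w = 0" unfolding t by simp
  qed
  then have inj: "inj_on F (span C)"
    using linear_inj_on_iff_eq_0[OF lin subspace_span] by blast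
  have indC: "independent C" by (rule independent_mono[OF B'(3)]) (simp add: C_def)
  have indFC: "independent (F ` C)" using linear_independent_injective_image[OF lin indC inj] .
  have "card (F ` C) = card C" using card_image inj_on_subset[OF inj span_superset] by blast
  also have "\<dots> = card B' - card B" unfolding C_def using finB B' by (intro card_Diff_subset) auto
  finally have cFC: "card T \<le> card (F ` C)"
    using card cB' card_mono[OF K(1) B(1)] by linarith
  have FCT: "F ` C \<subseteq> span T" using im B'(2) by (auto simp: C_def)
  have "T \<subseteq> span (F ` C)"
  proof
    fix y assume y: "y \<in> T"
    show "y \<in> span (F ` C)"
    proof (rule ccontr)
      assume ny: "y \<notin> span (F ` C)"
      then have "y \<notin> F ` C" using span_superset by blast
      have "independent (insert y (F ` C))" using ny indFC by (simp add: independent_insert \<open>y \<notin> F ` C\<close>)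
      moreover have "insert y (F ` C) \<subseteq> span T" using FCT y span_superset by blast
      ultimately have "card (insert y (F ` C)) \<le> card T"
        using real_vector.independent_span_bound[OF T] by blast
      then show False using cFC \<open>y \<notin> F ` C\<close> finC by simp
    qed
  qed
  then have "span T \<subseteq> span (F ` C)" using span_minimal subspace_span by blast
  also have "\<dots> = F ` span C" using linear_span_image[OF lin] .
  also have "\<dots> \<subseteq> F ` span B0" using CV by blast
  finally show ?thesis using im by blast
qed

lemma standard_basis:
  fixes A :: "'a set"
  assumes "finite A"
  defines "B \<equiv> (\<lambda>a. Poly_Mapping.single a (1::real)) ` A"
  shows "span B = {p. Poly_Mapping.keys p \<subseteq> A}" and "independent B" and "card B = card A" and "finite B"
proof -
  let ?e = "\<lambda>a. Poly_Mapping.single a (1::real)"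
  have inj: "inj_on ?e A"
    by (rule inj_onI) (metis lookup_single_eq lookup_single_not_eq zero_neq_one)
  show "card B = card A" "finite B" using assms card_image[OF inj] by auto
  show "independent B"
  proof (rule real_vector.independent_if_scalars_zero)
    show "finite B" using assms by auto
    fix f x assume z: "(\<Sum>x\<in>B. f x *\<^sub>R x) = 0" and "x \<in> B"
    then obtain a where a: "a \<in> A" "x = ?e a" unfolding B_def by auto
    have "0 = Poly_Mapping.lookup (\<Sum>b\<in>A. f (?e b) *\<^sub>R ?e b) a"
      using z unfolding B_def by (simp add: sum.reindex[OF inj])
    also have "\<dots> = (\<Sum>b\<in>A. if b = a then f (?e b) else 0)"
      unfolding lookup_sum by (rule sum.cong) (auto simp: lookup_single when_def)
    also have "\<dots> = f x" using a assms by simp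
    finally show "f x = 0" by simp
  qed
  show "span B = {p. Poly_Mapping.keys p \<subseteq> A}"
  proof
    show "span B \<subseteq> {p. Poly_Mapping.keys p \<subseteq> A}"
      unfolding B_def by (rule span_minimal[OF _ subspace_keys]) auto
    show "{p. Poly_Mapping.keys p \<subseteq> A} \<subseteq> span B"
    proof
      fix p :: "'a \<Rightarrow>\<^sub>0 real" assume "p \<in> {p. Poly_Mapping.keys p \<subseteq> A}"
      then have p: "a \<notin> A \<Longrightarrow> Poly_Mapping.lookup p a = 0" for a by (auto simp: in_keys_iff)
      have "p = (\<Sum>b\<in>A. Poly_Mapping.lookup p b *\<^sub>R ?e b)"
      proof (rule poly_mapping_eqI)
        fix a
        have "Poly_Mapping.lookup (\<Sum>b\<in>A. Poly_Mapping.lookup p b *\<^sub>R ?e b) a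
           = (\<Sum>b\<in>A. if b = a then Poly_Mapping.lookup p b else 0)"
          unfolding lookup_sum by (rule sum.cong) (auto simp: lookup_single when_def)
        then show "Poly_Mapping.lookup p a = Poly_Mapping.lookup (\<Sum>b\<in>A. Poly_Mapping.lookup p b *\<^sub>R ?e b) a"
          using p assms by simp
      qed
      then show "p \<in> span B" unfolding B_def
        by (metis (no_types, lifting) imageI span_base span_scale span_sum)
    qed
  qed
qed

text \<open>
  The \<open>n\<close> arcs of length \<open>k\<close> are distinct frozen sets: an arc of length \<open>k < n\<close> does not contain the
  predecessor of its starting point, but contains the predecessor of each of its other points.
\<close>

lemma card_nonfrozen:
  assumes k: "1 \<le> k" "k < n"
  shows "card {J \<in> nsets {1..n} k. nonfrozen n {} J} + n \<le> card (nsets {1..n} k)"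
proof -
  let ?I = "\<lambda>a. {x \<in> {1..n}. cdist n a x < k}"
  have cardI: "card (?I a) = k" if a: "a \<in> {1..n}" for a
  proof -
    have inj: "inj_on (cdist n a) {1..n}" using cdist_inj[OF a] by (auto intro!: inj_onI)
    have "cdist n a ` {1..n} \<subseteq> {..<n}" using cdist_less[OF a] by auto
    then have im: "cdist n a ` {1..n} = {..<n}"
      using card_image[OF inj] by (intro card_subset_eq) auto
    have "cdist n a ` ?I a = {..<k}"
    proof
      show "{..<k} \<subseteq> cdist n a ` ?I a"
      proof
        fix y assume y: "y \<in> {..<k}"
        then have "y \<in> cdist n a ` {1..n}" unfolding im using k by auto
        then show "y \<in> cdist n a ` ?I a" using y by blast
      qed
    qed auto
    moreover have "card (cdist n a ` ?I a) = card (?I a)"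
      by (rule card_image) (rule inj_on_subset[OF inj], auto)
    ultimately show ?thesis by simp
  qed
  have injI: "inj_on ?I {1..n}"
  proof (rule inj_onI, rule ccontr)
    fix a b assume a: "a \<in> {1..n}" and b: "b \<in> {1..n}" and eq: "?I a = ?I b" and ne: "a \<noteq> b"
    have "a \<in> ?I a" using a k by auto
    then have "a \<in> ?I b" unfolding eq .
    then have ab: "cdist n b a < k" by simp
    let ?p = "cyc_pred n a"
    have p: "?p \<in> {1..n}" using cyc_pred_in[OF a] .
    have "cdist n a ?p = n - 1"
      using a p k by (auto simp: cdist_eq cyc_pred_def split: if_splits)
    then have "?p \<notin> ?I a" using k by auto
    moreover have "cdist n b ?p < cdist n b a"
      using a b p ne k by (auto simp: cdist_eq cyc_pred_def split: if_splits)
    then have "?p \<in> ?I b" using ab p by simp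
    ultimately show False unfolding eq by blast
  qed
  let ?N = "{J \<in> nsets {1..n} k. nonfrozen n {} J}"
  have "cyclic_interval n {1..n} (?I a)" if "a \<in> {1..n}" for a
    using that unfolding cyclic_interval_def by blast
  then have "\<not> nonfrozen n {} (?I a)" if "a \<in> {1..n}" for a
    using that by (simp add: nonfrozen_def)
  then have disj: "?N \<inter> ?I ` {1..n} = {}" by blast
  have sub: "?I ` {1..n} \<subseteq> nsets {1..n} k"
  proof (rule image_subsetI)
    fix a assume "a \<in> {1..n}"
    then show "?I a \<in> nsets {1..n} k" using cardI[of a] by (auto simp: nsets_def)
  qed
  have finN: "finite ?N" using finite_subsets_n by simp
  have "card ?N + n = card ?N + card (?I ` {1..n})" using card_image[OF injI] by simp
  also have "\<dots> = card (?N \<union> ?I ` {1..n})"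
    using finN disj by (intro card_Un_disjoint[symmetric]) auto
  also have "\<dots> \<le> card (nsets {1..n} k)"
    using sub finite_subsets_n by (intro card_mono) auto
  finally show ?thesis .
qed

text \<open>
  The kernel is spanned by \<open>n\<close> vectors, and the blade space is missing at least \<open>n\<close> of the
  \<open>k\<close>-subsets as basis vectors, so the dimensions leave no room for a proper image.
\<close>

lemma Phi_image_plucker_space:
  assumes k: "2 \<le> k" "k \<le> n - 2"
  shows "Phi k n ` plucker_space k n = blade_space k n {}"
proof -
  have n: "n \<ge> 2" "1 \<le> k" "k < n" using k by linarith+
  let ?N = "{J \<in> nsets {1..n} k. nonfrozen n {} J}"
  let ?A = "Pair ({} :: nat set) ` ?N"
  have finA: "finite ?A" using finite_subsets_n by simp
  have cA: "card ?A = card ?N" by (rule card_image) (auto intro: inj_onI)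
  have "J \<in> nsets {1..n} k" if "nonfrozen n {} J" "card J = k" for J
    using that nonfrozen_finite[OF that(1)] by (auto simp: nsets_def nonfrozen_def)
  then have "{({}, J) | J. nonfrozen n {} J \<and> card J + card ({} :: nat set) = k} = ?A"
    by (auto simp: nsets_def)
  then have bs: "blade_space k n {} = {\<beta>. Poly_Mapping.keys \<beta> \<subseteq> ?A}"
    unfolding blade_space_def by simp
  note B0 = standard_basis[OF finite_subsets_n[of n k], folded plucker_space_def]
  note T = standard_basis[OF finA, folded bs]
  have K: "star_vector k n ` {1..n} \<subseteq> plucker_space k n" using star_vector_in by blast
  have "card (star_vector k n ` {1..n}) \<le> n" using card_image_le[of "{1..n}" "star_vector k n"] by simp
  then have c: "card ?A + card (star_vector k n ` {1..n}) \<le> card (nsets {1..n} k)"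
    using card_nonfrozen[OF n(2,3)] cA by linarith
  show ?thesis
    unfolding B0(1)[symmetric] T(1)[symmetric]
  proof (rule linear_image_eq_by_dimension[OF linear_Phi B0(4,2) T(4)])
    show "Phi k n ` span ((\<lambda>a. Poly_Mapping.single a 1) ` nsets {1..n} k)
        \<subseteq> span ((\<lambda>a. Poly_Mapping.single a 1) ` ?A)"
      unfolding B0(1) T(1) using Phi_in_blade_space[OF n(1)] by blast
    show "finite (star_vector k n ` {1..n})" by simp
    show "star_vector k n ` {1..n} \<subseteq> span ((\<lambda>a. Poly_Mapping.single a 1) ` nsets {1..n} k)"
      unfolding B0(1) by (rule K)
    show "v \<in> span (star_vector k n ` {1..n})"
      if "v \<in> span ((\<lambda>a. Poly_Mapping.single a 1) ` nsets {1..n} k)" "Phi k n v = 0" for v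
      using kernel_Phi_subset_lineality[OF k] that unfolding B0(1) lineality_space_eq by blast
  qed (use c B0(3) T(3) in simp)
qed

section \<open>Positive tropical Pluecker vectors and blades\<close>

theorem theorem4p16:
  fixes k n :: nat
  assumes "2 \<le> k" and "k \<le> n - 2"
  shows "linear (Phi k n) \<and>
         Phi k n ` plucker_space k n \<subseteq> blade_space k n {} \<and>
         Phi k n ` trop_plus_G k n = Z_set k n \<and>
         (\<forall>\<pi> \<in> trop_plus_G k n.
            {\<rho> \<in> trop_plus_G k n. Phi k n \<rho> = Phi k n \<pi>} = (\<lambda>v. \<pi> + v) ` lineality_space k n)"
proof (intro conjI ballI)
  have n: "2 \<le> n" using assms by linarith
  note Z = Phi_in_Z_set_iff[OF assms(1) n]
  have tp: "\<pi> \<in> plucker_space k n" if "\<pi> \<in> trop_plus_G k n" for \<pi>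
    using that by (simp add: trop_plus_G_def)
  show "linear (Phi k n)" by (rule linear_Phi)
  show "Phi k n ` plucker_space k n \<subseteq> blade_space k n {}"
    using Phi_image_plucker_space[OF assms] by simp
  show "Phi k n ` trop_plus_G k n = Z_set k n"
  proof
    show "Phi k n ` trop_plus_G k n \<subseteq> Z_set k n" using Z tp by blast
    show "Z_set k n \<subseteq> Phi k n ` trop_plus_G k n"
    proof
      fix \<beta> assume \<beta>: "\<beta> \<in> Z_set k n"
      then have "\<beta> \<in> Phi k n ` plucker_space k n"
        unfolding Phi_image_plucker_space[OF assms] by (simp add: Z_set_def)
      then show "\<beta> \<in> Phi k n ` trop_plus_G k n" using Z \<beta> by blast
    qed
  qed
  fix \<pi> assume \<pi>: "\<pi> \<in> trop_plus_G k n"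
  show "{\<rho> \<in> trop_plus_G k n. Phi k n \<rho> = Phi k n \<pi>} = (\<lambda>v. \<pi> + v) ` lineality_space k n"
  proof (rule set_eqI, rule iffI)
    fix \<rho> assume \<rho>: "\<rho> \<in> {\<rho> \<in> trop_plus_G k n. Phi k n \<rho> = Phi k n \<pi>}"
    then have "Phi k n (\<rho> - \<pi>) = 0" by (simp add: linear_diff[OF linear_Phi])
    moreover have "\<rho> - \<pi> \<in> plucker_space k n"
      using \<rho> \<pi> tp by (intro subspace_diff[OF subspace_plucker_space]) auto
    ultimately have "\<rho> - \<pi> \<in> lineality_space k n" by (intro kernel_Phi_subset_lineality[OF assms])
    then show "\<rho> \<in> (\<lambda>v. \<pi> + v) ` lineality_space k n" by (intro image_eqI[of _ _ "\<rho> - \<pi>"]) auto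
  next
    fix \<rho> assume "\<rho> \<in> (\<lambda>v. \<pi> + v) ` lineality_space k n"
    then obtain v where v: "v \<in> lineality_space k n" "\<rho> = \<pi> + v" by auto
    have eq: "Phi k n \<rho> = Phi k n \<pi>"
      using Phi_lineality[OF n v(1)] v(2) by (simp add: linear_add[OF linear_Phi])
    have "\<rho> \<in> plucker_space k n"
      using v tp[OF \<pi>] subspace_add[OF subspace_plucker_space] by (auto simp: lineality_space_iff)
    moreover have "Phi k n \<rho> \<in> Z_set k n" using eq Z[OF tp[OF \<pi>]] \<pi> by simp
    ultimately show "\<rho> \<in> {\<rho> \<in> trop_plus_G k n. Phi k n \<rho> = Phi k n \<pi>}" using Z eq by blast
  qed
qed

end
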